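(* Let $x=T_{qP}(y)$ be the coordinate given by the quasi-Poincaré compactification of type $\alpha$ and let $(s,\theta)=(s,\theta_1,\dots,\theta_{n-1})=T_{\bf h}(y)$ be the coordinate given by a directional compactification of the same type $\alpha$. Then the desingularized vector fields $\frac{dx}{d\tau}=g(x)$ and $\frac{d(s,\theta)}{d\tau_d}=g_d(s,\theta)$ are topologically equivalent on $\{s\ge 0\}\times M$.
   Context: **Asymptotically quasi-homogeneous fields.** Let $\alpha=(\alpha_1,\dots,\alpha_n)\ne(0,\dots,0)$ be nonnegative integers, $I_\alpha=\{i:\alpha_i>0\}$, $l=\#I_\alpha$. A set $U\subset\mathbb{R}^n$ is admissible with respect to $\alpha$ if it consists of all $x$ with $x_i\in\mathbb{R}$ arbitrary for $i\in I_\alpha$ and $(x_j)_{j\notin I_\alpha}\in\tilde U$ for an open set $\tilde U\subset\mathbb{R}^{n-l}$. A function $F$ is quasi-homogeneous of type $\alpha$ and order $m$ if $F(R^{\alpha_1}x_1,\dots,R^{\alpha_n}x_n)=R^mF(x)$ for all $x$ and $R\in\mathbb{R}$; a smooth vector field is quasi-homogeneous of type $\alpha$ and order $k+1$ if its $j$-th component is quasi-homogeneous of type $\alpha$ and order $k+\alpha_j$ for each $j$. A smooth $f:U\to\mathbb{R}^n$ ($U$ admissible), bounded in the remaining coordinates for each fixed value of $(x_i)_{i\in I_\alpha}$, is asymptotically quasi-homogeneous of type $\alpha$ and order $k+1$ at infinity if there is a quasi-homogeneous vector field $f_{\alpha,k}$ of type $\alpha$ and order $k+1$ such that, for all $j$,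 $\lim_{R\to+\infty}R^{-(k+\alpha_j)}\{f_j(R^{\alpha_1}x_1,\dots,R^{\alpha_n}x_n)-R^{k+\alpha_j}(f_{\alpha,k})_j(x)\}=0$ uniformly on $\{x:(x_i)_{i\in I_\alpha}\in S^{l-1},\ (x_j)_{j\notin I_\alpha}\in\tilde U\}$. Throughout, $y'=f(y)$ (with $'=d/dt$) where $f:U\to\mathbb{R}^n$ is smooth and asymptotically quasi-homogeneous of type $\alpha$ and order $k+1$, with integer $k\ge1$. **Quasi-Poincaré compactification.** Fix reals $a_1,\dots,a_n\ge1$, $c\in\mathbb{N}$ and integers $\beta_i$ with $\alpha_i\beta_i=c$ for $i\in I_\alpha$, $\beta_i=0$ otherwise. Put $p(y)=(\sum_{i\in I_\alpha}a_iy_i^{2\beta_i})^{1/2c}$, $\kappa(y)=(1+p(y)^{2c})^{1/2c}$, $T_{qP}(y)=x$ with $x_i=y_i/\kappa(y)^{\alpha_i}$. Let $\mathcal{D}=\{x=T_{qP}(y):y\in U\}=\{x\in U:p(x)<1\}$, $\mathcal{E}=\{x\in U:p(x)=1\}$ (the horizon), $\overline{\mathcal{D}}=\mathcal{D}\cup\mathcal{E}$. For $x\in\mathcal{D}$ set $\tilde f_j(x)=\kappa^{-(k+\alpha_j)}f_j(\kappa^{\alpha_1}x_1,\dots,\kappa^{\alpha_n}x_n)$ with $\kappa=\kappa(T_{qP}^{-1}(x))=(1-\sum_{j\in I_\alpha}a_jx_j^{2\beta_j})^{-1/2c}$, extended to $\mathcal{E}$ by its limit $(f_{\alpha,k})_j$.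 With $d\tau=\kappa(y(t))^kdt$, the desingularized vector field is $g_i(x)=\tilde f_i-\big(\sum_{j\in I_\alpha}\beta_ja_jx_j^{2\beta_j-1}\tilde f_j\big)\frac{x_i}{\beta_i}$ for $i\in I_\alpha$ and $g_i=\tilde f_i$ for $i\notin I_\alpha$. **Directional compactification.** A directional compactification of type $\alpha$ is a transformation $T_{\bf h}:(y_1,\dots,y_n)\mapsto(s,\theta_1,\dots,\theta_{n-1})$ given by $y_i=h_i(\theta)/s^{\alpha_i}$, where ${\bf h}=(h_1,\dots,h_n)$ are functions on an $(n-1)$-dimensional smooth manifold $M$ parameterized by $\theta=(\theta_1,\dots,\theta_{n-1})$ such that: (Dir1) $\bigcup_{s\ge0}(\{s\}\times{\bf h}(M))$ is a fiber bundle over $[0,\infty)$ whose fibers are diffeomorphic to $M$, and there is an open set of $\mathbb{R}^n$ that $T_{\bf h}$ maps diffeomorphically into $\bigcup_{s>0}(\{s\}\times{\bf h}(M))$; (Dir2) $\sum_{i\in I_\alpha}a_ih_i(\theta)^{2\beta_i}\ge c_h>0$ for all $\theta$; (Dir3) there is a smooth function $e$ with $s=e(y)$ and $e(y)\sim\kappa(y)^{-1}$ as $s\to0$, locally uniformly in $M$ ($F\sim G$ means $\lim F/G=C\neq0$); (Dir4) the $n\times n$ matrix $A(\theta)$ whose $i$-th row is $(\alpha_ih_i,\ \partial h_i/\partial\theta_1,\dots,\partial h_i/\partial\theta_{n-1})$ is invertible and smooth on $M$. Put $B=A^{-1}$ and $\hat f_j(s,\theta)=s^{k+\alpha_j}f_j(s^{-\alpha_1}h_1,\dots,s^{-\alpha_n}h_n)$,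 extended to $s=0$ by its limit. With $d\tau_d=s(t)^{-k}dt$, the desingularized vector field is $g_d(s,\theta)=\mathrm{diag}(-s,1,\dots,1)\,B\,(\hat f_1,\dots,\hat f_n)^T$. **Topological equivalence** means a homeomorphism (here the change of coordinates $(s,\theta)\mapsto x$ extended to $s=0$, from $\{s\ge0\}\times M$ onto its image in $\overline{\mathcal{D}}$) carrying trajectories onto trajectories and preserving the direction of time. *)

theory Defs
  imports "HOL-Analysis.Analysis"
begin

section \<open>Smooth maps and manifolds\<close>

primrec higher_differentiable_on ::
  "nat \<Rightarrow> 'a::real_normed_vector set \<Rightarrow> ('a \<Rightarrow> 'b::real_normed_vector) \<Rightarrow> bool" where
  "higher_differentiable_on 0 S f \<longleftrightarrow> continuous_on S f"
| "higher_differentiable_on (Suc r) S f \<longleftrightarrow>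
     (\<forall>x\<in>S. f differentiable (at x)) \<and>
     (\<forall>v. higher_differentiable_on r S (\<lambda>x. frechet_derivative f (at x) v))"

text \<open>Meant for open \<open>S\<close>.\<close>

definition smooth_on :: "'a::real_normed_vector set \<Rightarrow> ('a \<Rightarrow> 'b::real_normed_vector) \<Rightarrow> bool" where
  "smooth_on S f \<longleftrightarrow> (\<forall>r. higher_differentiable_on r S f)"

text \<open>Smooth maps between arbitrary subsets of Euclidean spaces, in the sense of Milnor's
  \<^emph>\<open>Topology from the Differentiable Viewpoint\<close>: locally the restriction of a smooth map that is
  defined on an open set.\<close>

definition smooth_map ::
  "'a::euclidean_space set \<Rightarrow> 'b::euclidean_space set \<Rightarrow> ('a \<Rightarrow> 'b) \<Rightarrow> bool" where
  "smooth_map X Y f \<longleftrightarrow> f ` X \<subseteq> Y \<and>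
     (\<forall>x\<in>X. \<exists>W F. open W \<and> x \<in> W \<and> smooth_on W F \<and> (\<forall>z\<in>W \<inter> X. F z = f z))"

definition diffeomorphism ::
  "'a::euclidean_space set \<Rightarrow> 'b::euclidean_space set \<Rightarrow> ('a \<Rightarrow> 'b) \<Rightarrow> bool" where
  "diffeomorphism X Y f \<longleftrightarrow>
     bij_betw f X Y \<and> smooth_map X Y f \<and> smooth_map Y X (inv_into X f)"

text \<open>The \<open>n\<close> coordinates \<open>(s, \<theta>\<^sub>1, \<dots>, \<theta>\<^bsub>n-1\<^esub>)\<close> are indexed by the same type \<open>'n\<close> as the
  coordinates of \<open>\<real>\<^sup>n\<close>: an arbitrary index \<open>i0\<close> is the label of \<open>s\<close>, the other
  indices are the labels of the \<open>\<theta>\<^sub>j\<close>. So the space \<open>\<real>\<^bsup>n-1\<^esup>\<close> of the \<open>\<theta>\<close>'s is the hyperplane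
  \<open>{v. v $ i0 = 0}\<close>; this also covers \<open>n = 1\<close>.\<close>

definition local_parametrization ::
  "'n::finite \<Rightarrow> 'm::euclidean_space set \<Rightarrow> (real^'n) set \<Rightarrow> (real^'n \<Rightarrow> 'm) \<Rightarrow> bool" where
  "local_parametrization i0 M P \<xi> \<longleftrightarrow>
     openin (top_of_set {v. v $ i0 = 0}) P \<and>
     openin (top_of_set M) (\<xi> ` P) \<and>
     diffeomorphism P (\<xi> ` P) \<xi>"

text \<open>An \<open>(n-1)\<close>-dimensional smooth manifold with an atlas of local parametrizations
  \<open>\<theta> \<mapsto> \<xi> \<theta>\<close>. Manifolds are taken as subsets of some Euclidean space. This is no restriction for
  a directional compactification, where \<open>M\<close> is diffeomorphic to the subset \<open>h ` M\<close> of \<open>\<real>\<^sup>n\<close>.\<close>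

definition smooth_manifold ::
  "'n::finite \<Rightarrow> 'm::euclidean_space set \<Rightarrow> ((real^'n) set \<times> (real^'n \<Rightarrow> 'm)) set \<Rightarrow> bool" where
  "smooth_manifold i0 M atlas \<longleftrightarrow>
     (\<forall>(P, \<xi>)\<in>atlas. local_parametrization i0 M P \<xi>) \<and> M = (\<Union>(P, \<xi>)\<in>atlas. \<xi> ` P)"

definition smooth_fiber_bundle ::
  "'e::euclidean_space set \<Rightarrow> 'b::euclidean_space set \<Rightarrow> ('e \<Rightarrow> 'b) \<Rightarrow> 'm::euclidean_space set \<Rightarrow> bool"
  where
  "smooth_fiber_bundle E B proj F \<longleftrightarrow> smooth_map E B proj \<and>
     (\<forall>b\<in>B. \<exists>W \<phi>. openin (top_of_set B) W \<and> b \<in> W \<and>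
        diffeomorphism {e\<in>E. proj e \<in> W} (W \<times> F) \<phi> \<and>
        (\<forall>e\<in>E. proj e \<in> W \<longrightarrow> fst (\<phi> e) = proj e))"


section \<open>Asymptotically quasi-homogeneous vector fields\<close>

definition hom_indices :: "('n \<Rightarrow> nat) \<Rightarrow> 'n set" where
  "hom_indices \<alpha> = {i. \<alpha> i > 0}"

text \<open>Points of \<open>\<real>\<^bsup>n-l\<^esup>\<close> are functions on the complement of \<open>hom_indices \<alpha>\<close>.\<close>

definition admissible :: "('n::finite \<Rightarrow> nat) \<Rightarrow> (real^'n) set \<Rightarrow> bool" where
  "admissible \<alpha> U \<longleftrightarrow>
     (\<exists>Ut. openin (product_topology (\<lambda>_. euclideanreal) (- hom_indices \<alpha>)) Ut \<and>
           U = {x. (\<lambda>i \<in> - hom_indices \<alpha>. x $ i) \<in> Ut})"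

definition qh_scale :: "('n::finite \<Rightarrow> nat) \<Rightarrow> real \<Rightarrow> real^'n \<Rightarrow> real^'n" where
  "qh_scale \<alpha> R x = (\<chi> i. R ^ \<alpha> i * x $ i)"

definition quasi_homogeneous ::
  "('n::finite \<Rightarrow> nat) \<Rightarrow> nat \<Rightarrow> (real^'n) set \<Rightarrow> (real^'n \<Rightarrow> real) \<Rightarrow> bool" where
  "quasi_homogeneous \<alpha> m U F \<longleftrightarrow> (\<forall>x\<in>U. \<forall>R. F (qh_scale \<alpha> R x) = R ^ m * F x)"

text \<open>The order of the vector field is \<open>k + 1\<close>.\<close>

definition quasi_homogeneous_field ::
  "('n::finite \<Rightarrow> nat) \<Rightarrow> nat \<Rightarrow> (real^'n) set \<Rightarrow> (real^'n \<Rightarrow> real^'n) \<Rightarrow> bool" where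
  "quasi_homogeneous_field \<alpha> k U F \<longleftrightarrow>
     smooth_on U F \<and> (\<forall>j. quasi_homogeneous \<alpha> (k + \<alpha> j) U (\<lambda>x. F x $ j))"

text \<open>\<open>f\<close> is asymptotically quasi-homogeneous of type \<open>\<alpha>\<close> and order \<open>k + 1\<close> on \<open>U\<close>, with
  quasi-homogeneous part \<open>fak\<close>.\<close>

definition asymptotically_quasi_homogeneous ::
  "('n::finite \<Rightarrow> nat) \<Rightarrow> nat \<Rightarrow> (real^'n) set \<Rightarrow> (real^'n \<Rightarrow> real^'n) \<Rightarrow> (real^'n \<Rightarrow> real^'n) \<Rightarrow> bool"
  where
  "asymptotically_quasi_homogeneous \<alpha> k U f fak \<longleftrightarrow>
     admissible \<alpha> U \<and> smooth_on U f \<and>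
     (\<forall>z. bounded (f ` {x\<in>U. \<forall>i\<in>hom_indices \<alpha>. x $ i = z $ i})) \<and>
     quasi_homogeneous_field \<alpha> k U fak \<and>
     (\<forall>j. uniform_limit {x\<in>U. (\<Sum>i\<in>hom_indices \<alpha>. (x $ i)\<^sup>2) = 1}
        (\<lambda>R x. (f (qh_scale \<alpha> R x) $ j - R ^ (k + \<alpha> j) * fak x $ j) / R ^ (k + \<alpha> j))
        (\<lambda>_. 0) at_top)"


section \<open>Quasi-Poincare compactification\<close>

definition compactification_weights ::
  "('n \<Rightarrow> nat) \<Rightarrow> ('n \<Rightarrow> nat) \<Rightarrow> ('n \<Rightarrow> real) \<Rightarrow> nat \<Rightarrow> bool" where
  "compactification_weights \<alpha> \<beta> a c \<longleftrightarrow> c > 0 \<and> (\<forall>i. a i \<ge> 1) \<and>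
     (\<forall>i\<in>hom_indices \<alpha>. \<alpha> i * \<beta> i = c) \<and> (\<forall>i. i \<notin> hom_indices \<alpha> \<longrightarrow> \<beta> i = 0)"

definition hsum ::
  "('n::finite \<Rightarrow> nat) \<Rightarrow> ('n \<Rightarrow> nat) \<Rightarrow> ('n \<Rightarrow> real) \<Rightarrow> real^'n \<Rightarrow> real" where
  "hsum \<alpha> \<beta> a y = (\<Sum>i\<in>hom_indices \<alpha>. a i * (y $ i) ^ (2 * \<beta> i))"

definition pfun ::
  "('n::finite \<Rightarrow> nat) \<Rightarrow> ('n \<Rightarrow> nat) \<Rightarrow> ('n \<Rightarrow> real) \<Rightarrow> nat \<Rightarrow> real^'n \<Rightarrow> real" where
  "pfun \<alpha> \<beta> a c y = root (2 * c) (hsum \<alpha> \<beta> a y)"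

definition kappa ::
  "('n::finite \<Rightarrow> nat) \<Rightarrow> ('n \<Rightarrow> nat) \<Rightarrow> ('n \<Rightarrow> real) \<Rightarrow> nat \<Rightarrow> real^'n \<Rightarrow> real" where
  "kappa \<alpha> \<beta> a c y = root (2 * c) (1 + pfun \<alpha> \<beta> a c y ^ (2 * c))"

definition TqP ::
  "('n::finite \<Rightarrow> nat) \<Rightarrow> ('n \<Rightarrow> nat) \<Rightarrow> ('n \<Rightarrow> real) \<Rightarrow> nat \<Rightarrow> real^'n \<Rightarrow> real^'n" where
  "TqP \<alpha> \<beta> a c y = (\<chi> i. y $ i / kappa \<alpha> \<beta> a c y ^ \<alpha> i)"

definition qP_disk ::
  "('n::finite \<Rightarrow> nat) \<Rightarrow> ('n \<Rightarrow> nat) \<Rightarrow> ('n \<Rightarrow> real) \<Rightarrow> nat \<Rightarrow> (real^'n) set \<Rightarrow> (real^'n) set" where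
  "qP_disk \<alpha> \<beta> a c U = TqP \<alpha> \<beta> a c ` U"

definition qP_horizon ::
  "('n::finite \<Rightarrow> nat) \<Rightarrow> ('n \<Rightarrow> nat) \<Rightarrow> ('n \<Rightarrow> real) \<Rightarrow> nat \<Rightarrow> (real^'n) set \<Rightarrow> (real^'n) set" where
  "qP_horizon \<alpha> \<beta> a c U = {x\<in>U. pfun \<alpha> \<beta> a c x = 1}"

text \<open>\<open>kappa\<close> in terms of \<open>x = TqP y\<close>.\<close>

definition kappa_disk ::
  "('n::finite \<Rightarrow> nat) \<Rightarrow> ('n \<Rightarrow> nat) \<Rightarrow> ('n \<Rightarrow> real) \<Rightarrow> nat \<Rightarrow> real^'n \<Rightarrow> real" where
  "kappa_disk \<alpha> \<beta> a c x = 1 / root (2 * c) (1 - hsum \<alpha> \<beta> a x)"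

definition ftilde ::
  "('n::finite \<Rightarrow> nat) \<Rightarrow> ('n \<Rightarrow> nat) \<Rightarrow> ('n \<Rightarrow> real) \<Rightarrow> nat \<Rightarrow> nat \<Rightarrow>
     (real^'n \<Rightarrow> real^'n) \<Rightarrow> (real^'n \<Rightarrow> real^'n) \<Rightarrow> real^'n \<Rightarrow> real^'n" where
  "ftilde \<alpha> \<beta> a c k f fak x =
     (if pfun \<alpha> \<beta> a c x < 1
      then \<chi> j. f (qh_scale \<alpha> (kappa_disk \<alpha> \<beta> a c x) x) $ j / kappa_disk \<alpha> \<beta> a c x ^ (k + \<alpha> j)
      else fak x)"

definition qP_field ::
  "('n::finite \<Rightarrow> nat) \<Rightarrow> ('n \<Rightarrow> nat) \<Rightarrow> ('n \<Rightarrow> real) \<Rightarrow> nat \<Rightarrow> nat \<Rightarrow>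
     (real^'n \<Rightarrow> real^'n) \<Rightarrow> (real^'n \<Rightarrow> real^'n) \<Rightarrow> real^'n \<Rightarrow> real^'n" where
  "qP_field \<alpha> \<beta> a c k f fak x =
     (let ft = ftilde \<alpha> \<beta> a c k f fak x in
      \<chi> i. if i \<in> hom_indices \<alpha>
           then ft $ i - (\<Sum>j\<in>hom_indices \<alpha>. real (\<beta> j) * a j * (x $ j) ^ (2 * \<beta> j - 1) * ft $ j)
                           * (x $ i / real (\<beta> i))
           else ft $ i)"


section \<open>Directional compactification\<close>

text \<open>The point \<open>y\<close> with directional coordinates \<open>(s, \<theta>)\<close>, for \<open>s > 0\<close>.\<close>

definition dir_point ::
  "('n::finite \<Rightarrow> nat) \<Rightarrow> ('m \<Rightarrow> real^'n) \<Rightarrow> real \<Rightarrow> 'm \<Rightarrow> real^'n" where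
  "dir_point \<alpha> h s \<theta> = (\<chi> i. h \<theta> $ i / s ^ \<alpha> i)"

text \<open>The matrix \<open>A\<close> in the local parametrization \<open>\<xi>\<close>, at the point \<open>\<xi> u\<close>; the column \<open>i0\<close> is
  \<open>(\<alpha>\<^sub>i h\<^sub>i)\<^sub>i\<close>.\<close>

definition dir_matrix ::
  "'n::finite \<Rightarrow> ('n \<Rightarrow> nat) \<Rightarrow> ('m \<Rightarrow> real^'n) \<Rightarrow> (real^'n \<Rightarrow> 'm) \<Rightarrow> real^'n \<Rightarrow> real^'n^'n" where
  "dir_matrix i0 \<alpha> h \<xi> u =
     (\<chi> i j. if j = i0 then real (\<alpha> i) * h (\<xi> u) $ i
             else deriv (\<lambda>t. h (\<xi> (u + t *\<^sub>R axis j 1)) $ i) 0)"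

text \<open>\<open>Th\<close> is the transformation \<open>y \<mapsto> (s, \<theta>)\<close>, with \<open>\<theta> \<in> M\<close>; it is defined on the open set \<open>V\<close>.
  In the first condition on \<open>Th\<close>, \<open>M\<close> is identified with \<open>h ` M\<close>. In the condition on the
  asymptotics of \<open>e\<close>, the limit \<open>C\<close> of \<open>e(y) / \<kappa>(y)\<^sup>-\<^sup>1\<close> is a function of \<open>\<theta>\<close>.\<close>

definition directional_compactification ::
  "'n::finite \<Rightarrow> ('n \<Rightarrow> nat) \<Rightarrow> ('n \<Rightarrow> nat) \<Rightarrow> ('n \<Rightarrow> real) \<Rightarrow> nat \<Rightarrow> (real^'n) set \<Rightarrow>
     'm::euclidean_space set \<Rightarrow> ((real^'n) set \<times> (real^'n \<Rightarrow> 'm)) set \<Rightarrow>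
     ('m \<Rightarrow> real^'n) \<Rightarrow> (real^'n) set \<Rightarrow> (real^'n \<Rightarrow> real \<times> 'm) \<Rightarrow> bool" where
  "directional_compactification i0 \<alpha> \<beta> a c U M atlas h V Th \<longleftrightarrow>
     smooth_manifold i0 M atlas \<and> smooth_map M UNIV h \<and>
     smooth_fiber_bundle (\<Union>s\<in>{0::real..}. {s} \<times> h ` M) {0..} fst M \<and>
     open V \<and> V \<subseteq> U \<and>
     diffeomorphism V ({0<..} \<times> M) Th \<and>
     (\<forall>y\<in>V. y = dir_point \<alpha> h (fst (Th y)) (snd (Th y))) \<and>
     (\<exists>ch>0. \<forall>\<theta>\<in>M. hsum \<alpha> \<beta> a (h \<theta>) \<ge> ch) \<and>
     (\<exists>e :: real^'n \<Rightarrow> real. smooth_on V e \<and> (\<forall>y\<in>V. fst (Th y) = e y) \<and>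
        (\<exists>C :: 'm \<Rightarrow> real. (\<forall>\<theta>\<in>M. C \<theta> \<noteq> 0) \<and>
           (\<forall>\<theta>\<^sub>0\<in>M. \<exists>N. openin (top_of_set M) N \<and> \<theta>\<^sub>0 \<in> N \<and>
              uniform_limit N
                (\<lambda>s \<theta>. e (dir_point \<alpha> h s \<theta>) / (1 / kappa \<alpha> \<beta> a c (dir_point \<alpha> h s \<theta>)))
                C (at_right 0)))) \<and>
     (\<forall>(P, \<xi>)\<in>atlas. smooth_map P UNIV (dir_matrix i0 \<alpha> h \<xi>) \<and>
        (\<forall>u\<in>P. invertible (dir_matrix i0 \<alpha> h \<xi> u)))"

definition fhat ::
  "('n::finite \<Rightarrow> nat) \<Rightarrow> nat \<Rightarrow> (real^'n \<Rightarrow> real^'n) \<Rightarrow> ('m \<Rightarrow> real^'n) \<Rightarrow> real \<Rightarrow> 'm \<Rightarrow> real^'n" where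
  "fhat \<alpha> k f h s \<theta> =
     (\<chi> j. if s > 0 then s ^ (k + \<alpha> j) * f (dir_point \<alpha> h s \<theta>) $ j
           else Lim (at_right 0) (\<lambda>r. r ^ (k + \<alpha> j) * f (dir_point \<alpha> h r \<theta>) $ j))"

text \<open>The field \<open>g\<^sub>d\<close> in the coordinates of the local parametrization \<open>\<xi>\<close>, at the point
  \<open>(s, \<xi> u)\<close>.\<close>

definition dir_field ::
  "'n::finite \<Rightarrow> ('n \<Rightarrow> nat) \<Rightarrow> nat \<Rightarrow> (real^'n \<Rightarrow> real^'n) \<Rightarrow> ('m \<Rightarrow> real^'n) \<Rightarrow>
     (real^'n \<Rightarrow> 'm) \<Rightarrow> real \<Rightarrow> real^'n \<Rightarrow> real^'n" where
  "dir_field i0 \<alpha> k f h \<xi> s u =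
     (\<chi> i j. if i = j then if i = i0 then - s else 1 else 0)
       *v (matrix_inv (dir_matrix i0 \<alpha> h \<xi> u) *v fhat \<alpha> k f h s (\<xi> u))"


section \<open>Trajectories and topological equivalence\<close>

definition open_interval :: "real set \<Rightarrow> bool" where
  "open_interval J \<longleftrightarrow> open J \<and> is_interval J \<and> J \<noteq> {}"

definition solution_in :: "'a::real_normed_vector set \<Rightarrow> ('a \<Rightarrow> 'a) \<Rightarrow> real set \<Rightarrow> (real \<Rightarrow> 'a) \<Rightarrow> bool"
  where
  "solution_in X g J x \<longleftrightarrow> open_interval J \<and>
     (\<forall>t\<in>J. x t \<in> X \<and> (x has_vector_derivative g (x t)) (at t))"

text \<open>The coordinate vector of \<open>(s, \<theta>)\<close>, with \<open>\<theta> \<in> \<xi> ` P\<close>.\<close>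

definition dir_coords ::
  "'n::finite \<Rightarrow> (real^'n) set \<Rightarrow> (real^'n \<Rightarrow> 'm) \<Rightarrow> real \<times> 'm \<Rightarrow> real^'n" where
  "dir_coords i0 P \<xi> z = (\<chi> i. if i = i0 then fst z else inv_into P \<xi> (snd z) $ i)"

text \<open>Solutions of \<open>d(s, \<theta>)/d\<tau>\<^sub>d = g\<^sub>d(s, \<theta>)\<close> in \<open>{0..} \<times> M\<close>. By continuity, a curve stays in the
  domain of a chart for times close to \<open>t\<close> if it is there at time \<open>t\<close>.\<close>

definition dir_solution ::
  "'n::finite \<Rightarrow> ('n \<Rightarrow> nat) \<Rightarrow> nat \<Rightarrow> (real^'n \<Rightarrow> real^'n) \<Rightarrow> 'm::euclidean_space set \<Rightarrow>
     ((real^'n) set \<times> (real^'n \<Rightarrow> 'm)) set \<Rightarrow> ('m \<Rightarrow> real^'n) \<Rightarrow>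
     real set \<Rightarrow> (real \<Rightarrow> real \<times> 'm) \<Rightarrow> bool" where
  "dir_solution i0 \<alpha> k f M atlas h J \<gamma> \<longleftrightarrow> open_interval J \<and> continuous_on J \<gamma> \<and>
     (\<forall>t\<in>J. \<gamma> t \<in> {0..} \<times> M \<and>
        (\<forall>(P, \<xi>)\<in>atlas. snd (\<gamma> t) \<in> \<xi> ` P \<longrightarrow>
           ((\<lambda>r. dir_coords i0 P \<xi> (\<gamma> r)) has_vector_derivative
              dir_field i0 \<alpha> k f h \<xi> (fst (\<gamma> t)) (inv_into P \<xi> (snd (\<gamma> t)))) (at t)))"

text \<open>Trajectories are maximal solutions.\<close>

definition trajectory ::
  "(real set \<Rightarrow> (real \<Rightarrow> 'a) \<Rightarrow> bool) \<Rightarrow> real set \<Rightarrow> (real \<Rightarrow> 'a) \<Rightarrow> bool" where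
  "trajectory sol J x \<longleftrightarrow> sol J x \<and>
     (\<forall>J' x'. sol J' x' \<and> J \<subseteq> J' \<and> (\<forall>t\<in>J. x' t = x t) \<longrightarrow> J' = J)"

text \<open>\<open>y\<close> on \<open>J'\<close> and \<open>x\<close> on \<open>J\<close> are the same curve up to an increasing change of time.\<close>

definition same_oriented_curve ::
  "real set \<Rightarrow> (real \<Rightarrow> 'a) \<Rightarrow> real set \<Rightarrow> (real \<Rightarrow> 'a) \<Rightarrow> bool" where
  "same_oriented_curve J x J' y \<longleftrightarrow>
     (\<exists>\<sigma>. strict_mono_on J' \<sigma> \<and> \<sigma> ` J' = J \<and> (\<forall>t\<in>J'. y t = x (\<sigma> t)))"

text \<open>\<open>\<Phi>\<close> is a topological equivalence between the system on \<open>X\<close> with solutions \<open>sol1\<close> and the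
  system on \<open>Y\<close> with solutions \<open>sol2\<close>.\<close>

definition topological_equivalence ::
  "'a::topological_space set \<Rightarrow> (real set \<Rightarrow> (real \<Rightarrow> 'a) \<Rightarrow> bool) \<Rightarrow>
   'b::topological_space set \<Rightarrow> (real set \<Rightarrow> (real \<Rightarrow> 'b) \<Rightarrow> bool) \<Rightarrow> ('a \<Rightarrow> 'b) \<Rightarrow> bool" where
  "topological_equivalence X sol1 Y sol2 \<Phi> \<longleftrightarrow>
     (\<exists>\<Phi>'. homeomorphism X Y \<Phi> \<Phi>') \<and>
     (\<forall>J \<gamma>. trajectory sol1 J \<gamma> \<longrightarrow>
        (\<exists>J' x. trajectory sol2 J' x \<and> same_oriented_curve J (\<Phi> \<circ> \<gamma>) J' x)) \<and>
     (\<forall>J' x. trajectory sol2 J' x \<longrightarrow>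
        (\<exists>J \<gamma>. trajectory sol1 J \<gamma> \<and> same_oriented_curve J (\<Phi> \<circ> \<gamma>) J' x))"

end

theory Submission
  imports Defs
begin

text \<open>Put \<open>\<rho>(s, \<theta>) = (s\<^sup>2\<^sup>c + \<Sum> a\<^sub>i h\<^sub>i(\<theta>)^(2\<beta>\<^sub>i))^(1/2c)\<close>. A point \<open>y\<close> with \<open>y\<^sub>i = h\<^sub>i(\<theta>) / s^\<alpha>\<^sub>i\<close>
  has \<open>\<kappa>(y) = \<rho> / s\<close>, so the powers of \<open>s\<close> cancel in \<open>x = T\<^sub>q\<^sub>P(y)\<close> and \<open>x\<^sub>i = h\<^sub>i(\<theta>) / \<rho>^\<alpha>\<^sub>i\<close>.
  The sum in \<open>\<rho>\<close> is bounded away from \<open>0\<close>, so this formula makes sense for \<open>s = 0\<close> too and defines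
  the extended change of coordinates \<open>\<Phi>\<close>. Read differently, it says that \<open>\<Phi>(s, \<theta>)\<close> is the point
  of \<open>V\<close> with directional coordinates \<open>(\<rho>, \<theta>)\<close>. Hence \<open>\<theta>\<close> and \<open>\<rho>\<close> depend continuously, even
  smoothly, on \<open>\<Phi>(s, \<theta>)\<close> through \<open>Th\<close>, and \<open>\<Phi>\<close> is a homeomorphism from \<open>{s \<ge> 0} \<times> M\<close> onto
  \<open>{x \<in> V. \<Sum> a\<^sub>i x\<^sub>i^(2\<beta>\<^sub>i) \<le> 1}\<close> (\<open>Phi_homeomorphism\<close>).

  A point \<open>h\<^sub>i(\<theta>) / r^\<alpha>\<^sub>i\<close> whose coordinates \<open>(r, \<theta>)\<close> move has the velocity
  \<open>r^(-\<alpha>\<^sub>i) (A (-r'/r, \<theta>'))\<^sub>i\<close> (\<open>dir_point_velocity\<close>). With \<open>r = \<rho>\<close> and the identity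
  \<open>fhat\<^sub>j = \<rho>^(k + \<alpha>\<^sub>j) ftilde\<^sub>j\<close>, a solution of the directional system is mapped to a curve with
  \<open>x' = \<rho>\<^sup>k g(x)\<close> (\<open>Phi_velocity\<close>), at \<open>s = 0\<close> as well as at \<open>s > 0\<close>; the term \<open>\<rho>'/\<rho>\<close> is found by
  differentiating \<open>\<Sum> a\<^sub>i x\<^sub>i^(2\<beta>\<^sub>i) = 1 - (s/\<rho>)\<^sup>2\<^sup>c\<close>. Conversely (\<open>Psi_velocity\<close>), a solution \<open>x\<close> of
  \<open>x' = g(x)\<close> determines \<open>\<theta>'\<close> and \<open>\<rho>'\<close> because \<open>A\<close> is invertible. However
  \<open>s = \<rho> (1 - \<Sum> a\<^sub>i x\<^sub>i^(2\<beta>\<^sub>i))^(1/2c)\<close> is not a differentiable function of \<open>x\<close> on the horizon. What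
  helps is that \<open>w = 1 - \<Sum> a\<^sub>i x\<^sub>i^(2\<beta>\<^sub>i)\<close> satisfies a linear equation \<open>w' = -2 S w\<close>, where \<open>S\<close> is
  bounded near the horizon by the uniformity of the limit that defines asymptotic
  quasi-homogeneity: a solution that meets the horizon stays in it (\<open>horizon_invariant\<close>), and \<open>s\<close> is
  constantly \<open>0\<close> along it.

  Since \<open>f\<close> is controlled at infinity only by a uniform limit, \<open>g\<close> need not be Lipschitz near the
  horizon and solutions need not be unique there, so that there may be no flow to conjugate. The trajectories are
  compared one by one instead: a change of time with speed \<open>\<rho>\<^sup>k\<close> turns solutions of one system into
  solutions of the other, and a proper extension of the image of a maximal solution could be
  transported back to a proper extension of the original (\<open>topological_equivalence_time_change\<close>).\<close>

section \<open>Smooth maps and derivatives\<close>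

lemma smooth_on_imp_differentiable:
  assumes "smooth_on S f" "x \<in> S" shows "f differentiable (at x)"
  using assms unfolding smooth_on_def by (auto dest!: spec[of _ "Suc 0"])

lemma smooth_on_imp_continuous_on: "smooth_on S f \<Longrightarrow> continuous_on S f"
  unfolding smooth_on_def by (auto dest!: spec[of _ 0])

lemma smooth_map_imp_continuous_on:
  assumes "smooth_map X Y f" shows "continuous_on X f"
proof (clarsimp simp: continuous_on_def)
  fix x assume "x \<in> X"
  then obtain W F where W: "open W" "x \<in> W" "smooth_on W F" "\<And>z. z \<in> W \<inter> X \<Longrightarrow> F z = f z"
    using assms unfolding smooth_map_def by blast
  have "(F \<longlongrightarrow> F x) (at x)"
    using smooth_on_imp_continuous_on[OF W(3)] W(1,2)
    by (simp add: continuous_on_eq_continuous_at isCont_def)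
  then have "(F \<longlongrightarrow> f x) (at x within X)"
    using W(4)[of x] W(2) \<open>x \<in> X\<close> by (auto intro: tendsto_within_subset)
  moreover have "\<forall>\<^sub>F z in at x within X. F z = f z"
    unfolding eventually_at_topological using W by blast
  ultimately show "(f \<longlongrightarrow> f x) (at x within X)" by (metis (no_types) tendsto_cong)
qed

lemma has_vector_derivative_vec_iff:
  fixes x :: "real \<Rightarrow> real^'n"
  shows "(x has_vector_derivative d) (at t) \<longleftrightarrow>
    (\<forall>i. ((\<lambda>r. x r $ i) has_real_derivative d $ i) (at t))"
proof -
  have "(x has_vector_derivative d) (at t) \<longleftrightarrow>
    (\<forall>i. ((\<lambda>r. x r \<bullet> axis i 1) has_derivative (\<lambda>r. (r *\<^sub>R d) \<bullet> axis i 1)) (at t))"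
    unfolding has_vector_derivative_def
    by (subst has_derivative_componentwise_within) (auto simp: Basis_vec_def)
  moreover have "(\<lambda>r. (r *\<^sub>R d) \<bullet> axis i 1) = (*) (d $ i)" for i
    by (simp add: inner_axis fun_eq_iff mult.commute)
  ultimately show ?thesis
    by (simp add: has_field_derivative_def inner_axis)
qed

lemma has_vector_derivative_eventually_eq:
  assumes "(F has_vector_derivative d) (at t)" "\<forall>\<^sub>F r in nhds t. F r = G r"
  shows "(G has_vector_derivative d) (at t)"
  using has_vector_derivative_cong_ev[of UNIV F G t d] assms eventually_nhds_x_imp_x[OF assms(2)] by simp

lemma has_vector_derivative_time_change:
  assumes "(\<sigma> has_real_derivative d) (at r)" "(F has_vector_derivative v) (at (\<sigma> r))"
  shows "((\<lambda>r. F (\<sigma> r)) has_vector_derivative d *\<^sub>R v) (at r)"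
  using vector_diff_chain_at[of \<sigma> d r F v] assms
  by (simp add: o_def has_real_derivative_iff_has_vector_derivative)

text \<open>The form in which smoothness on a manifold enters the chain rule: \<open>f\<close> itself
  need not have a derivative at points of \<open>X\<close>, but along a curve in \<open>X\<close> it can be replaced by \<open>F\<close>.\<close>

lemma smooth_map_local_derivative:
  assumes "smooth_map X Y f" "x \<in> X"
  shows "\<exists>W F F'. open W \<and> x \<in> W \<and> (F has_derivative F') (at x) \<and> (\<forall>z\<in>W \<inter> X. F z = f z)"
proof -
  obtain W F where W: "open W" "x \<in> W" "smooth_on W F" "\<forall>z\<in>W \<inter> X. F z = f z"
    using assms unfolding smooth_map_def by blast
  obtain F' where "(F has_derivative F') (at x)"
    using smooth_on_imp_differentiable[OF W(3,2)] unfolding differentiable_def by blast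
  then show ?thesis using W by blast
qed

lemma matrix_inv:
  fixes A :: "real^'k^'k"
  assumes "invertible A"
  shows matrix_inv_right: "A ** matrix_inv A = mat 1" and matrix_inv_left: "matrix_inv A ** A = mat 1"
  using assms unfolding invertible_def matrix_inv_def by (metis (mono_tags, lifting) someI_ex)+

text \<open>The zero set of \<open>w\<close> is closed in \<open>J\<close>. It is also open: if \<open>\<bar>b\<bar> \<le> C\<close> near a zero, then
  \<open>w(t) exp(-C t)\<close> is nonincreasing and \<open>w(t) exp(C t)\<close> is nondecreasing there, so the nonnegative
  function \<open>w\<close> cannot leave \<open>0\<close> in either direction. Bounds
  near the zeros suffice; for the field \<open>g\<close> they come from its asymptotics near the horizon.\<close>

lemma vanishes_of_linear_bound:
  fixes w :: "real \<Rightarrow> real"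
  assumes J: "open_interval J" and dw: "\<And>t. t \<in> J \<Longrightarrow> (w has_real_derivative b t * w t) (at t)"
    and nonneg: "\<And>t. t \<in> J \<Longrightarrow> w t \<ge> 0"
    and bdd: "\<And>t. t \<in> J \<Longrightarrow> w t = 0 \<Longrightarrow> \<exists>C. \<forall>\<^sub>F r in at t. \<bar>b r\<bar> \<le> C"
    and t0: "t0 \<in> J" "w t0 = 0" and t: "t \<in> J"
  shows "w t = 0"
proof -
  have opJ: "open J" and conn: "connected J"
    using J by (auto simp: open_interval_def is_interval_connected_1)
  have contw: "continuous_on J w"
    using dw by (meson DERIV_isCont continuous_at_imp_continuous_on)
  define Z where "Z = {t\<in>J. w t = 0}"
  have "closedin (top_of_set J) Z"
    unfolding Z_def using continuous_closedin_preimage_constant[OF contw] by simp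
  moreover have "openin (top_of_set J) Z"
  proof -
    have "\<exists>S. open S \<and> t1 \<in> S \<and> S \<subseteq> Z" if "t1 \<in> Z" for t1
    proof -
      have t1: "t1 \<in> J" "w t1 = 0" using that by (auto simp: Z_def)
      obtain C where C: "\<forall>\<^sub>F r in at t1. \<bar>b r\<bar> \<le> C" using bdd[OF t1] by blast
      then obtain d1 where d1: "d1 > 0" "\<And>r. r \<noteq> t1 \<Longrightarrow> dist r t1 < d1 \<Longrightarrow> \<bar>b r\<bar> \<le> C"
        unfolding eventually_at by blast
      obtain d2 where d2: "d2 > 0" "ball t1 d2 \<subseteq> J" using opJ t1 open_contains_ball by blast
      define d where "d = min d1 d2"
      have d: "d > 0" and sub: "\<And>r. \<bar>r - t1\<bar> < d \<Longrightarrow> r \<in> J"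
        and bC: "\<And>r. r \<noteq> t1 \<Longrightarrow> \<bar>r - t1\<bar> < d \<Longrightarrow> \<bar>b r\<bar> \<le> C"
        using d1 d2 by (auto simp: d_def dist_real_def subset_eq)
      have exp_mono: "((\<lambda>r. w r * exp (e * r)) has_real_derivative (b r + e) * w r * exp (e * r)) (at r)"
        if "\<bar>r - t1\<bar> < d" for r e
        using dw[OF sub[OF that]] by (auto intro!: derivative_eq_intros simp: algebra_simps)
      have "w r = 0" if r: "\<bar>r - t1\<bar> < d" for r
      proof -
        have bw: "(b u - C) * w u \<le> 0" "(b u + C) * w u \<ge> 0" if "\<bar>u - t1\<bar> < d" for u
        proof -
          have "u = t1 \<or> (b u - C \<le> 0 \<and> b u + C \<ge> 0)" using bC[OF _ that] by (auto simp: abs_le_iff)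
          then show "(b u - C) * w u \<le> 0" "(b u + C) * w u \<ge> 0"
            using nonneg[OF sub[OF that]] t1 by (auto simp: mult_nonpos_nonneg)
        qed
        have "w r \<le> 0"
        proof (cases "t1 \<le> r")
          case True
          have "w r * exp (- C * r) \<le> w t1 * exp (- C * t1)"
          proof (rule DERIV_nonpos_imp_nonincreasing[OF True])
            fix u assume "t1 \<le> u" "u \<le> r"
            then have u: "\<bar>u - t1\<bar> < d" using r by auto
            have "(b u + - C) * w u * exp (- C * u) \<le> 0"
              using bw(1)[OF u] by (simp add: mult_nonpos_nonneg)
            then show "\<exists>y. ((\<lambda>r. w r * exp (- C * r)) has_real_derivative y) (at u) \<and> y \<le> 0"
              using exp_mono[OF u, of "- C"] by blast
          qed
          then show ?thesis using t1 by (simp add: mult_le_0_iff)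
        next
          case False
          then have "r \<le> t1" by simp
          have "w r * exp (C * r) \<le> w t1 * exp (C * t1)"
          proof (rule DERIV_nonneg_imp_nondecreasing[OF \<open>r \<le> t1\<close>])
            fix u assume "r \<le> u" "u \<le> t1"
            then have u: "\<bar>u - t1\<bar> < d" using r by auto
            have "(b u + C) * w u * exp (C * u) \<ge> 0"
              using bw(2)[OF u] by simp
            then show "\<exists>y. ((\<lambda>r. w r * exp (C * r)) has_real_derivative y) (at u) \<and> y \<ge> 0"
              using exp_mono[OF u, of C] by blast
          qed
          then show ?thesis using t1 by (simp add: mult_le_0_iff)
        qed
        then show ?thesis using nonneg[OF sub[OF r]] by simp
      qed
      then have "ball t1 d \<subseteq> Z" using sub by (auto simp: Z_def dist_real_def abs_minus_commute)
      then show ?thesis using d by (meson centre_in_ball open_ball)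
    qed
    then have "open Z" by (subst open_subopen) blast
    then show ?thesis by (simp add: Z_def open_openin_trans opJ subset_eq)
  qed
  ultimately have "Z = {} \<or> Z = J" using conn connected_clopen by blast
  then show ?thesis using t0 t by (auto simp: Z_def)
qed

section \<open>Change of time along maximal solutions\<close>

text \<open>The new clock \<open>T\<close> is the integral of the speed \<open>w\<close>, and \<open>\<sigma>\<close> is its inverse. The value \<open>r0\<close> at \<open>t0\<close>
  can be prescribed so that two clocks can be synchronized.\<close>

lemma time_change_exists:
  fixes w :: "real \<Rightarrow> real"
  assumes J: "open_interval J" and w: "continuous_on J w" "\<And>t. t \<in> J \<Longrightarrow> w t > 0" and t0: "t0 \<in> J"
  shows "\<exists>T \<sigma>. open_interval (T ` J) \<and> T t0 = r0 \<and> inj_on T J \<and>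
    (\<forall>t\<in>J. (T has_real_derivative w t) (at t)) \<and>
    (\<forall>t\<in>J. \<sigma> (T t) = t) \<and> strict_mono_on (T ` J) \<sigma> \<and>
    (\<forall>r\<in>T ` J. (\<sigma> has_real_derivative 1 / w (\<sigma> r)) (at r))"
proof -
  define T where "T t = r0 + (LBINT y=t0..t. w y)" for t :: real
  have opJ: "open J" and ivJ: "is_interval J"
    using J by (auto simp: open_interval_def)
  have hull: "{a..b} \<subseteq> J" if "a \<in> J" "b \<in> J" for a b
    using mem_is_interval_1_I[OF ivJ that] by auto
  have nbhd: "\<exists>a b. a < t \<and> t < b \<and> a \<in> J \<and> b \<in> J" if "t \<in> J" for t
  proof -
    obtain e where e: "e > 0" "ball t e \<subseteq> J" using opJ \<open>t \<in> J\<close> open_contains_ball by blast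
    have "t - e/2 \<in> ball t e" "t + e/2 \<in> ball t e" using e by (auto simp: dist_real_def)
    then show ?thesis using e by (intro exI[of _ "t - e/2"] exI[of _ "t + e/2"]) auto
  qed
  have dT: "(T has_real_derivative w t) (at t)" if "t \<in> J" for t
  proof -
    obtain a b where ab: "a < t" "t < b" "a \<in> J" "b \<in> J" using nbhd[OF \<open>t \<in> J\<close>] by blast
    define a' b' where "a' = min a t0" and "b' = max b t0"
    have ab': "a' < t" "t < b'" "a' \<le> t0" "t0 \<le> b'" "a' \<in> J" "b' \<in> J"
      using ab t0 by (auto simp: a'_def b'_def min_def max_def)
    have "continuous_on {a'..b'} w"
      using w(1) hull ab' continuous_on_subset by blast
    then have "((\<lambda>u. LBINT y=t0..u. w y) has_vector_derivative w t) (at t within {a'..b'})"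
      using interval_integral_FTC2[of a' t0 b' w t] ab' by auto
    then have "((\<lambda>u. LBINT y=t0..u. w y) has_vector_derivative w t) (at t)"
      using ab' by (simp add: at_within_Icc_at)
    then show ?thesis
      unfolding T_def has_real_derivative_iff_has_vector_derivative
      by (auto intro!: derivative_eq_intros)
  qed
  have Tmono: "T a < T b" if "a \<in> J" "b \<in> J" "a < b" for a b
  proof (rule DERIV_pos_imp_increasing[OF \<open>a < b\<close>])
    fix x assume "a \<le> x" "x \<le> b"
    then have "x \<in> J" using hull[OF that(1,2)] by auto
    then show "\<exists>y. DERIV T x :> y \<and> y > 0" using dT w(2) by blast
  qed
  have injT: "inj_on T J"
    by (rule inj_onI) (metis Tmono less_irrefl linorder_neqE_linordered_idom)
  define \<sigma> where "\<sigma> = inv_into J T"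
  have \<sigma>T: "\<sigma> (T t) = t" if "t \<in> J" for t
    using injT that by (simp add: \<sigma>_def)
  have contT: "continuous_on J T"
    using dT by (meson DERIV_isCont continuous_at_imp_continuous_on)
  have ivJ': "is_interval (T ` J)"
    using contT ivJ by (metis connected_continuous_image is_interval_connected_1)
  have "open (T ` J)"
  proof (subst open_subopen, rule ballI)
    fix r assume "r \<in> T ` J"
    then obtain t where t: "t \<in> J" "r = T t" by blast
    obtain a b where ab: "a < t" "t < b" "a \<in> J" "b \<in> J" using nbhd[OF t(1)] by blast
    have "{T a<..<T b} \<subseteq> T ` J"
      using mem_is_interval_1_I[OF ivJ', of "T a" "T b"] ab by auto
    moreover have "r \<in> {T a<..<T b}" using Tmono ab t by auto
    ultimately show "\<exists>S. open S \<and> r \<in> S \<and> S \<subseteq> T ` J"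
      by (meson open_greaterThanLessThan)
  qed
  then have J': "open_interval (T ` J)"
    using ivJ' t0 by (auto simp: open_interval_def)
  have "T t0 = r0" by (simp add: T_def)
  moreover have "strict_mono_on (T ` J) \<sigma>"
  proof (rule strict_mono_onI)
    fix r s assume "r \<in> T ` J" "s \<in> T ` J" "r < s"
    then obtain t u where tu: "t \<in> J" "u \<in> J" "r = T t" "s = T u" by blast
    then have "\<not> u \<le> t" using Tmono[of u t] \<open>r < s\<close> by (cases "u = t") auto
    then show "\<sigma> r < \<sigma> s" using tu \<sigma>T by simp
  qed
  moreover have "(\<sigma> has_real_derivative 1 / w (\<sigma> r)) (at r)" if "r \<in> T ` J" for r
  proof -
    obtain t where t: "t \<in> J" "r = T t" using \<open>r \<in> T ` J\<close> by blast
    have "w t \<noteq> 0" using w(2)[OF t(1)] by simp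
    then have inv: "(*) (w t) \<circ> (*) (1 / w t) = id" by (auto simp: fun_eq_iff)
    have "(\<sigma> has_derivative (*) (1 / w t)) (at (T t))"
      by (rule has_derivative_inverse_strong[OF opJ t(1) contT \<sigma>T
          dT[OF t(1), unfolded has_field_derivative_def] inv])
    then show ?thesis using t \<sigma>T by (simp add: has_field_derivative_def)
  qed
  ultimately show ?thesis using J' injT dT \<sigma>T by blast
qed

text \<open>Maximality survives the change of time although solutions may branch. Suppose the transformed
  solution had an extension. Run it with its own clock \<open>T2\<close>, synchronized with \<open>\<sigma>\<close> at one point; as
  \<open>mB (\<Phi> z) = 1 / mA z\<close>, the two clocks have the same speed on the smaller interval, hence coincide there.
  So the extension goes back to a solution that extends \<open>\<gamma>\<close> and therefore equals it.\<close>

lemma trajectory_time_change: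
  assumes solA: "\<And>J \<gamma>. solA J \<gamma> \<Longrightarrow> open_interval J \<and> \<gamma> ` J \<subseteq> X \<and> continuous_on J (\<lambda>t. mA (\<gamma> t))"
    and solB: "\<And>J x. solB J x \<Longrightarrow> open_interval J \<and> x ` J \<subseteq> Y \<and> continuous_on J (\<lambda>t. mB (x t))"
    and AB: "\<And>J \<gamma> J' \<sigma>. \<lbrakk>solA J \<gamma>; open_interval J'; \<sigma> ` J' = J;
      \<And>r. r \<in> J' \<Longrightarrow> (\<sigma> has_real_derivative 1 / mA (\<gamma> (\<sigma> r))) (at r)\<rbrakk> \<Longrightarrow> solB J' (\<lambda>r. \<Phi> (\<gamma> (\<sigma> r)))"
    and BA: "\<And>J x J' \<sigma>. \<lbrakk>solB J x; open_interval J'; \<sigma> ` J' = J;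
      \<And>r. r \<in> J' \<Longrightarrow> (\<sigma> has_real_derivative 1 / mB (x (\<sigma> r))) (at r)\<rbrakk> \<Longrightarrow> solA J' (\<lambda>r. \<Psi> (x (\<sigma> r)))"
    and \<Psi>\<Phi>: "\<And>z. z \<in> X \<Longrightarrow> \<Psi> (\<Phi> z) = z"
    and mA: "\<And>z. z \<in> X \<Longrightarrow> mA z > (0::real)"
    and mB: "\<And>z. z \<in> Y \<Longrightarrow> mB z > (0::real)"
    and mAB: "\<And>z. z \<in> X \<Longrightarrow> mB (\<Phi> z) = 1 / mA z"
    and traj: "trajectory solA J \<gamma>"
  shows "\<exists>J' \<sigma>. trajectory solB J' (\<lambda>r. \<Phi> (\<gamma> (\<sigma> r))) \<and> strict_mono_on J' \<sigma> \<and> \<sigma> ` J' = J"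
proof -
  have sol: "solA J \<gamma>"
    and max: "\<And>J' x'. solA J' x' \<Longrightarrow> J \<subseteq> J' \<Longrightarrow> (\<forall>t\<in>J. x' t = \<gamma> t) \<Longrightarrow> J' = J"
    using traj by (auto simp: trajectory_def)
  have J: "open_interval J" and \<gamma>X: "\<And>t. t \<in> J \<Longrightarrow> \<gamma> t \<in> X"
    and cont: "continuous_on J (\<lambda>t. mA (\<gamma> t))"
    using solA[OF sol] by auto
  obtain t0 where t0: "t0 \<in> J" using J by (auto simp: open_interval_def)
  have pos: "mA (\<gamma> t) > 0" if "t \<in> J" for t
    using mA \<gamma>X that by blast
  obtain T \<sigma> where T: "open_interval (T ` J)" "\<forall>t\<in>J. \<sigma> (T t) = t" "strict_mono_on (T ` J) \<sigma>"
      "\<forall>r\<in>T ` J. (\<sigma> has_real_derivative 1 / mA (\<gamma> (\<sigma> r))) (at r)"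
    using time_change_exists[OF J cont pos t0, of 0] by blast
  define J' where "J' = T ` J"
  have J': "open_interval J'" and \<sigma>: "strict_mono_on J' \<sigma>" "\<sigma> ` J' = J"
    and d\<sigma>: "\<And>r. r \<in> J' \<Longrightarrow> (\<sigma> has_real_derivative 1 / mA (\<gamma> (\<sigma> r))) (at r)"
    using T by (auto simp: J'_def image_image)
  define x where "x r = \<Phi> (\<gamma> (\<sigma> r))" for r
  have solx: "solB J' x"
    unfolding x_def by (rule AB[OF sol J' \<sigma>(2) d\<sigma>])
  have "J2 = J'" if sol2: "solB J2 x2" and sub: "J' \<subseteq> J2" and ext: "\<forall>t\<in>J'. x2 t = x t" for J2 x2
  proof -
    have J2: "open_interval J2" and x2Y: "\<And>t. t \<in> J2 \<Longrightarrow> x2 t \<in> Y"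
      and cont2: "continuous_on J2 (\<lambda>t. mB (x2 t))"
      using solB[OF sol2] by auto
    obtain r0 where r0: "r0 \<in> J'" using J' by (auto simp: open_interval_def)
    then have "r0 \<in> J2" using sub by blast
    have pos2: "mB (x2 t) > 0" if "t \<in> J2" for t
      using mB x2Y that by blast
    obtain T2 \<sigma>2 where T2r0: "T2 r0 = \<sigma> r0" and inj: "inj_on T2 J2"
      and T2: "open_interval (T2 ` J2)"
        "\<forall>t\<in>J2. (T2 has_real_derivative mB (x2 t)) (at t)" "\<forall>t\<in>J2. \<sigma>2 (T2 t) = t"
        "\<forall>r\<in>T2 ` J2. (\<sigma>2 has_real_derivative 1 / mB (x2 (\<sigma>2 r))) (at r)"
      using time_change_exists[OF J2 cont2 pos2 \<open>r0 \<in> J2\<close>, of "\<sigma> r0"] by blast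
    define J3 where "J3 = T2 ` J2"
    have J3: "open_interval J3" and \<sigma>2: "\<sigma>2 ` J3 = J2"
      and dT2: "\<And>t. t \<in> J2 \<Longrightarrow> (T2 has_real_derivative mB (x2 t)) (at t)"
      and \<sigma>2T2: "\<And>t. t \<in> J2 \<Longrightarrow> \<sigma>2 (T2 t) = t"
      and d\<sigma>2: "\<And>r. r \<in> J3 \<Longrightarrow> (\<sigma>2 has_real_derivative 1 / mB (x2 (\<sigma>2 r))) (at r)"
      using T2 by (auto simp: J3_def image_image)
    \<comment> \<open>Both clocks run at the same speed on the smaller interval and agree at \<open>r0\<close>.\<close>
    have agree: "T2 r = \<sigma> r" if "r \<in> J'" for r
    proof -
      have "((\<lambda>r. T2 r - \<sigma> r) has_real_derivative 0) (at r within J')" if r: "r \<in> J'" for r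
      proof -
        have "\<sigma> r \<in> J" using \<sigma>(2) r by blast
        then have "mB (x2 r) = 1 / mA (\<gamma> (\<sigma> r))"
          using ext r mAB[OF \<gamma>X] by (simp add: x_def)
        then have "((\<lambda>r. T2 r - \<sigma> r) has_real_derivative 0) (at r)"
          using DERIV_diff[OF dT2 d\<sigma>[OF r]] sub r by fastforce
        then show ?thesis by (rule DERIV_subset) simp
      qed
      moreover have "convex J'" using J' by (simp add: open_interval_def is_interval_convex)
      ultimately obtain C where C: "\<And>r. r \<in> J' \<Longrightarrow> T2 r - \<sigma> r = C"
        using has_field_derivative_zero_constant[of J' "\<lambda>r. T2 r - \<sigma> r"] by blast
      show ?thesis using C[OF r0] C[OF that] T2r0 by simp
    qed
    have "J3 = J"
    proof (rule max)
      show "solA J3 (\<lambda>r. \<Psi> (x2 (\<sigma>2 r)))" by (rule BA[OF sol2 J3 \<sigma>2 d\<sigma>2])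
      show "J \<subseteq> J3"
        using \<sigma>(2) agree sub by (force simp: J3_def)
      show "\<forall>t\<in>J. \<Psi> (x2 (\<sigma>2 t)) = \<gamma> t"
      proof
        fix t assume "t \<in> J"
        then obtain r where r: "r \<in> J'" "t = \<sigma> r" using \<sigma>(2) by blast
        then have "\<sigma>2 t = r" using agree \<sigma>2T2 sub by (metis subsetD)
        then show "\<Psi> (x2 (\<sigma>2 t)) = \<gamma> t" using ext r \<Psi>\<Phi> \<gamma>X \<open>t \<in> J\<close> by (simp add: x_def)
      qed
    qed
    then have "T2 ` J2 = T2 ` J'" using agree \<sigma>(2) by (auto simp: J3_def)
    then show "J2 = J'" using inj sub by (metis inj_on_image_eq_iff subset_refl)
  qed
  then have "trajectory solB J' x" using solx by (auto simp: trajectory_def)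
  then show ?thesis using \<sigma> by (auto simp: x_def[abs_def])
qed

text \<open>The hypotheses on \<open>\<Phi>\<close> and \<open>\<Psi>\<close> with the speeds \<open>m\<close> and \<open>1/m\<close> are symmetric in the two systems, so the
  previous lemma applies in both directions. In the second one the time change it yields
  runs from the times of \<open>\<gamma>\<close> to those of \<open>x\<close> and has to be inverted.\<close>

lemma topological_equivalence_time_change:
  assumes hom: "homeomorphism X Y \<Phi> \<Psi>"
    and solA: "\<And>J \<gamma>. solA J \<gamma> \<Longrightarrow> open_interval J \<and> \<gamma> ` J \<subseteq> X \<and> continuous_on J \<gamma>"
    and solB: "\<And>J x. solB J x \<Longrightarrow> open_interval J \<and> x ` J \<subseteq> Y \<and> continuous_on J x"
    and m: "continuous_on X m" "\<And>z. z \<in> X \<Longrightarrow> m z > (0::real)"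
    and AB: "\<And>J \<gamma> J' \<sigma>. \<lbrakk>solA J \<gamma>; open_interval J'; \<sigma> ` J' = J;
      \<And>r. r \<in> J' \<Longrightarrow> (\<sigma> has_real_derivative 1 / m (\<gamma> (\<sigma> r))) (at r)\<rbrakk> \<Longrightarrow> solB J' (\<lambda>r. \<Phi> (\<gamma> (\<sigma> r)))"
    and BA: "\<And>J x J' \<sigma>. \<lbrakk>solB J x; open_interval J'; \<sigma> ` J' = J;
      \<And>r. r \<in> J' \<Longrightarrow> (\<sigma> has_real_derivative m (\<Psi> (x (\<sigma> r)))) (at r)\<rbrakk> \<Longrightarrow> solA J' (\<lambda>r. \<Psi> (x (\<sigma> r)))"
  shows "topological_equivalence X solA Y solB \<Phi>"
proof -
  have inv: "\<And>z. z \<in> X \<Longrightarrow> \<Psi> (\<Phi> z) = z" "\<And>y. y \<in> Y \<Longrightarrow> \<Phi> (\<Psi> y) = y"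
    and im: "\<Phi> ` X = Y" "\<Psi> ` Y = X" and cont: "continuous_on Y \<Psi>"
    using hom by (auto simp: homeomorphism_def)
  define m' where "m' y = 1 / m (\<Psi> y)" for y
  have m': "continuous_on Y m'" "\<And>y. y \<in> Y \<Longrightarrow> m' y > 0"
  proof -
    have pos: "m (\<Psi> y) > 0" if "y \<in> Y" for y
      using that m(2) im(2) by blast
    then show "m' y > 0" if "y \<in> Y" for y
      using that by (simp add: m'_def)
    have "continuous_on Y (\<lambda>y. m (\<Psi> y))"
      by (rule continuous_on_compose2[OF m(1) cont]) (simp add: im)
    then show "continuous_on Y m'"
      unfolding m'_def using pos by (intro continuous_on_divide continuous_on_const) (auto simp: less_imp_neq[symmetric])
  qed
  have solA': "open_interval J \<and> \<gamma> ` J \<subseteq> X \<and> continuous_on J (\<lambda>t. m (\<gamma> t))" if "solA J \<gamma>" for J \<gamma>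
    using solA[OF that] continuous_on_compose2[OF m(1)] by blast
  have solB': "open_interval J \<and> x ` J \<subseteq> Y \<and> continuous_on J (\<lambda>t. m' (x t))" if "solB J x" for J x
    using solB[OF that] continuous_on_compose2[OF m'(1)] by blast
  have BA': "solA J' (\<lambda>r. \<Psi> (x (\<sigma> r)))"
    if "solB J x" "open_interval J'" "\<sigma> ` J' = J"
      "\<And>r. r \<in> J' \<Longrightarrow> (\<sigma> has_real_derivative 1 / m' (x (\<sigma> r))) (at r)" for J x J' \<sigma>
    by (rule BA[OF that(1-3)]) (use that(4) in \<open>simp add: m'_def\<close>)
  have "\<exists>J' x. trajectory solB J' x \<and> same_oriented_curve J (\<Phi> \<circ> \<gamma>) J' x"
    if "trajectory solA J \<gamma>" for J \<gamma>
  proof -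
    have rel: "m' (\<Phi> z) = 1 / m z" if "z \<in> X" for z using that inv by (simp add: m'_def)
    have "\<exists>J' \<sigma>. trajectory solB J' (\<lambda>r. \<Phi> (\<gamma> (\<sigma> r))) \<and> strict_mono_on J' \<sigma> \<and> \<sigma> ` J' = J"
    proof (rule trajectory_time_change[where solA=solA and solB=solB and mA=m and mB=m' and X=X
          and Y=Y and \<Phi>=\<Phi> and \<Psi>=\<Psi>])
      show "open_interval K \<and> \<eta> ` K \<subseteq> X \<and> continuous_on K (\<lambda>t. m (\<eta> t))" if "solA K \<eta>" for K \<eta>
        by (rule solA'[OF that])
      show "open_interval K \<and> \<eta> ` K \<subseteq> Y \<and> continuous_on K (\<lambda>t. m' (\<eta> t))" if "solB K \<eta>" for K \<eta>
        by (rule solB'[OF that])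
      show "solB K (\<lambda>r. \<Phi> (\<eta> (\<sigma> r)))"
        if "solA L \<eta>" "open_interval K" "\<sigma> ` K = L"
          "\<And>r. r \<in> K \<Longrightarrow> (\<sigma> has_real_derivative 1 / m (\<eta> (\<sigma> r))) (at r)" for L \<eta> K \<sigma>
        by (rule AB[OF that])
      show "solA K (\<lambda>r. \<Psi> (\<eta> (\<sigma> r)))"
        if "solB L \<eta>" "open_interval K" "\<sigma> ` K = L"
          "\<And>r. r \<in> K \<Longrightarrow> (\<sigma> has_real_derivative 1 / m' (\<eta> (\<sigma> r))) (at r)" for L \<eta> K \<sigma>
        by (rule BA'[OF that])
    qed (use that rel inv(1) m(2) m'(2)  in auto)
    then obtain J' \<sigma> where "trajectory solB J' (\<lambda>r. \<Phi> (\<gamma> (\<sigma> r)))" "strict_mono_on J' \<sigma>" "\<sigma> ` J' = J"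
      by blast
    then show ?thesis unfolding same_oriented_curve_def by (intro exI[of _ J'] exI[of _ "\<lambda>r. \<Phi> (\<gamma> (\<sigma> r))"] conjI exI[of _ \<sigma>]) auto
  qed
  moreover have "\<exists>J \<gamma>. trajectory solA J \<gamma> \<and> same_oriented_curve J (\<Phi> \<circ> \<gamma>) J' x"
    if "trajectory solB J' x" for J' x
  proof -
    have rel: "m (\<Psi> y) = 1 / m' y" for y by (simp add: m'_def)
    have "\<exists>J \<sigma>. trajectory solA J (\<lambda>r. \<Psi> (x (\<sigma> r))) \<and> strict_mono_on J \<sigma> \<and> \<sigma> ` J = J'"
    proof (rule trajectory_time_change[where solA=solB and solB=solA and mA=m' and mB=m and X=Y
          and Y=X and \<Phi>=\<Psi> and \<Psi>=\<Phi>])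
      show "open_interval K \<and> \<eta> ` K \<subseteq> Y \<and> continuous_on K (\<lambda>t. m' (\<eta> t))" if "solB K \<eta>" for K \<eta>
        by (rule solB'[OF that])
      show "open_interval K \<and> \<eta> ` K \<subseteq> X \<and> continuous_on K (\<lambda>t. m (\<eta> t))" if "solA K \<eta>" for K \<eta>
        by (rule solA'[OF that])
      show "solA K (\<lambda>r. \<Psi> (\<eta> (\<sigma> r)))"
        if "solB L \<eta>" "open_interval K" "\<sigma> ` K = L"
          "\<And>r. r \<in> K \<Longrightarrow> (\<sigma> has_real_derivative 1 / m' (\<eta> (\<sigma> r))) (at r)" for L \<eta> K \<sigma>
        by (rule BA'[OF that])
      show "solB K (\<lambda>r. \<Phi> (\<eta> (\<sigma> r)))"
        if "solA L \<eta>" "open_interval K" "\<sigma> ` K = L"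
          "\<And>r. r \<in> K \<Longrightarrow> (\<sigma> has_real_derivative 1 / m (\<eta> (\<sigma> r))) (at r)" for L \<eta> K \<sigma>
        by (rule AB[OF that])
    qed (use that rel inv(2) m'(2) m(2)  in auto)
    then obtain J \<sigma> where J: "trajectory solA J (\<lambda>r. \<Psi> (x (\<sigma> r)))" "strict_mono_on J \<sigma>" "\<sigma> ` J = J'"
      by blast
    have "solB J' x" using that by (simp add: trajectory_def)
    then have xY: "\<And>t. t \<in> J' \<Longrightarrow> x t \<in> Y" using solB by blast
    have inj: "inj_on \<sigma> J" using J(2) strict_mono_on_imp_inj_on by blast
    define \<rho> where "\<rho> = inv_into J \<sigma>"
    have \<rho>: "\<rho> (\<sigma> t) = t" if "t \<in> J" for t using inj that by (simp add: \<rho>_def)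
    have "strict_mono_on J' \<rho>"
    proof (rule strict_mono_onI)
      fix r s assume "r \<in> J'" "s \<in> J'" "r < s"
      then obtain t u where "t \<in> J" "u \<in> J" "r = \<sigma> t" "s = \<sigma> u" using J(3) by blast
      then show "\<rho> r < \<rho> s" using \<open>r < s\<close> \<rho> strict_mono_on_less[OF J(2)] by auto
    qed
    moreover have "\<rho> ` J' = J" using J(3) \<rho> by force
    moreover have "\<forall>t\<in>J'. x t = \<Phi> (\<Psi> (x (\<sigma> (\<rho> t))))"
      using J(3) \<rho> inv(2) xY by force
    ultimately show ?thesis
      using J(1) unfolding same_oriented_curve_def by (intro exI[of _ J] exI[of _ "\<lambda>r. \<Psi> (x (\<sigma> r))"] conjI exI[of _ \<rho>]) auto
  qed
  ultimately show ?thesis using hom unfolding topological_equivalence_def by blast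
qed

section \<open>Asymptotics of the vector field at infinity\<close>

lemma qh_scale_qh_scale: "qh_scale \<alpha> R (qh_scale \<alpha> Q x) = qh_scale \<alpha> (R * Q) x"
  by (simp add: qh_scale_def vec_eq_iff power_mult_distrib)

lemma qh_scale_one [simp]: "qh_scale \<alpha> 1 x = x"
  by (simp add: qh_scale_def vec_eq_iff)

lemma qh_scale_nth [simp]: "qh_scale \<alpha> R x $ i = R ^ \<alpha> i * x $ i"
  by (simp add: qh_scale_def)

lemma dir_point_eq_qh_scale: "dir_point \<alpha> h s \<theta> = qh_scale \<alpha> (1 / s) (h \<theta>)"
  by (simp add: qh_scale_def dir_point_def vec_eq_iff power_divide)

lemma admissible_qh_scale:
  assumes "admissible \<alpha> U" "x \<in> U" shows "qh_scale \<alpha> R x \<in> U"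
proof -
  have "(\<lambda>i \<in> - hom_indices \<alpha>. qh_scale \<alpha> R x $ i) = (\<lambda>i \<in> - hom_indices \<alpha>. x $ i)"
    by (rule restrict_ext) (simp add: hom_indices_def)
  then show ?thesis using assms by (auto simp: admissible_def)
qed

text \<open>The intermediate value theorem for the sum of squares along the orbit \<open>\<mu> \<mapsto> qh_scale \<alpha> \<mu> x\<close>. The bounds
  hold because the exponents \<open>\<alpha> i\<close> with \<open>i \<in> hom_indices \<alpha>\<close> are at least \<open>1\<close>: the sum is at least \<open>\<mu>\<^sup>2 \<delta>\<close> for
  \<open>\<mu> \<ge> 1\<close> and at most \<open>\<mu>\<^sup>2 B\<close> for \<open>\<mu> \<le> 1\<close>.\<close>

lemma qh_scale_to_sphere:
  fixes x :: "real^'n"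
  assumes \<delta>: "0 < \<delta>" "\<delta> \<le> 1" "\<delta> \<le> (\<Sum>i\<in>hom_indices \<alpha>. (x $ i)\<^sup>2)"
    and B: "1 \<le> B" "(\<Sum>i\<in>hom_indices \<alpha>. (x $ i)\<^sup>2) \<le> B"
  obtains \<mu> where "1 / sqrt B \<le> \<mu>" "\<mu> \<le> 1 / sqrt \<delta>"
    "(\<Sum>i\<in>hom_indices \<alpha>. (qh_scale \<alpha> \<mu> x $ i)\<^sup>2) = 1"
proof -
  define \<phi> where "\<phi> \<mu> = (\<Sum>i\<in>hom_indices \<alpha>. (qh_scale \<alpha> \<mu> x $ i)\<^sup>2)" for \<mu>
  define u where "u = 1 / sqrt \<delta>"
  have u: "u \<ge> 1" "u\<^sup>2 * \<delta> = 1" using \<delta> by (auto simp: u_def power_divide)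
  have "\<phi> 0 = 0"
    unfolding \<phi>_def by (intro sum.neutral) (auto simp: hom_indices_def)
  moreover have "\<phi> u \<ge> 1"
  proof -
    have "u\<^sup>2 * (x $ i)\<^sup>2 \<le> (qh_scale \<alpha> u x $ i)\<^sup>2" if "i \<in> hom_indices \<alpha>" for i
    proof -
      have "u ^ 1 \<le> u ^ \<alpha> i" using u that by (intro power_increasing) (auto simp: hom_indices_def)
      then have "u\<^sup>2 \<le> (u ^ \<alpha> i)\<^sup>2" using u by (intro power_mono) auto
      then show ?thesis by (simp add: power_mult_distrib mult_right_mono)
    qed
    then have "u\<^sup>2 * (\<Sum>i\<in>hom_indices \<alpha>. (x $ i)\<^sup>2) \<le> \<phi> u"
      unfolding \<phi>_def sum_distrib_left by (rule sum_mono)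
    moreover have "u\<^sup>2 * \<delta> \<le> u\<^sup>2 * (\<Sum>i\<in>hom_indices \<alpha>. (x $ i)\<^sup>2)"
      using \<delta> by (intro mult_left_mono) auto
    ultimately show ?thesis using u by linarith
  qed
  moreover have "\<forall>\<mu>. 0 \<le> \<mu> \<and> \<mu> \<le> u \<longrightarrow> isCont \<phi> \<mu>"
    unfolding \<phi>_def qh_scale_nth by (auto intro!: continuous_intros)
  ultimately obtain \<mu> where \<mu>: "0 \<le> \<mu>" "\<mu> \<le> u" "\<phi> \<mu> = 1"
    using IVT[of \<phi> 0 1 u] u by auto
  \<comment> \<open>For \<open>\<mu> < 1\<close> the value \<open>1\<close> of \<open>\<phi>\<close> is at most \<open>\<mu>\<^sup>2 B\<close>.\<close>
  have "1 / sqrt B \<le> \<mu>"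
  proof (cases "\<mu> \<ge> 1")
    case True
    have "1 / sqrt B \<le> 1" using B by simp
    then show ?thesis using True by linarith
  next
    case False
    have "(qh_scale \<alpha> \<mu> x $ i)\<^sup>2 \<le> \<mu>\<^sup>2 * (x $ i)\<^sup>2" if "i \<in> hom_indices \<alpha>" for i
    proof -
      have "\<mu> ^ \<alpha> i \<le> \<mu> ^ 1" using \<mu> False that by (intro power_decreasing) (auto simp: hom_indices_def)
      then have "(\<mu> ^ \<alpha> i)\<^sup>2 \<le> \<mu>\<^sup>2" using \<mu> by (intro power_mono) auto
      then show ?thesis by (simp add: power_mult_distrib mult_right_mono)
    qed
    then have "\<phi> \<mu> \<le> \<mu>\<^sup>2 * (\<Sum>i\<in>hom_indices \<alpha>. (x $ i)\<^sup>2)"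
      unfolding \<phi>_def sum_distrib_left by (rule sum_mono)
    also have "\<dots> \<le> \<mu>\<^sup>2 * B" using B by (intro mult_left_mono) auto
    finally have "(1 / sqrt B)\<^sup>2 \<le> \<mu>\<^sup>2" using B \<mu> by (simp add: power_divide field_simps)
    then show ?thesis using \<mu>(1) by (rule power2_le_imp_le)
  qed
  then show ?thesis using \<mu> that by (simp add: \<phi>_def u_def)
qed

text \<open>The uniform limit on the unit sphere extends to sets that are bounded and bounded away from \<open>0\<close> in
  the homogeneous coordinates: \<open>x\<close> is moved to the sphere by a scaling with a factor in a fixed compact
  subinterval of the positive reals, which only changes \<open>R\<close> and the error by bounded factors. For one
  point it gives the limit of the field at the horizon, for a neighbourhood it gives a bound.\<close>

lemma asymptotically_quasi_homogeneous_uniform: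
  fixes K :: "(real^'n) set"
  assumes f: "asymptotically_quasi_homogeneous \<alpha> k U f fak"
    and K: "K \<subseteq> U" "\<And>x. x \<in> K \<Longrightarrow> \<delta> \<le> (\<Sum>i\<in>hom_indices \<alpha>. (x $ i)\<^sup>2)"
      "\<And>x. x \<in> K \<Longrightarrow> (\<Sum>i\<in>hom_indices \<alpha>. (x $ i)\<^sup>2) \<le> B" and "\<delta> > 0" and \<epsilon>: "\<epsilon> > 0"
  shows "\<exists>R0>0. \<forall>R\<ge>R0. \<forall>x\<in>K. \<bar>f (qh_scale \<alpha> R x) $ j / R ^ (k + \<alpha> j) - fak x $ j\<bar> < \<epsilon>"
proof -
  define m where "m = k + \<alpha> j"
  define \<delta>' B' where "\<delta>' = min 1 \<delta>" and "B' = max 1 B"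
  define l u where "l = 1 / sqrt B'" and "u = 1 / sqrt \<delta>'"
  have l: "l > 0" and u: "u > 0" using \<open>\<delta> > 0\<close> by (auto simp: l_def u_def \<delta>'_def B'_def)
  define S where "S = {x\<in>U. (\<Sum>i\<in>hom_indices \<alpha>. (x $ i)\<^sup>2) = 1}"
  have adm: "admissible \<alpha> U"
    and fak: "\<And>x R. x \<in> U \<Longrightarrow> fak (qh_scale \<alpha> R x) $ j = R ^ m * fak x $ j"
    and lim: "uniform_limit S (\<lambda>R x. (f (qh_scale \<alpha> R x) $ j - R ^ m * fak x $ j) / R ^ m) (\<lambda>_. 0) at_top"
    using f by (auto simp: asymptotically_quasi_homogeneous_def quasi_homogeneous_field_def
      quasi_homogeneous_def m_def S_def)
  have "\<epsilon> * l ^ m > 0" using \<epsilon> l by simp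
  then obtain R1 where R1: "\<And>R z. R \<ge> R1 \<Longrightarrow> z \<in> S \<Longrightarrow>
      \<bar>(f (qh_scale \<alpha> R z) $ j - R ^ m * fak z $ j) / R ^ m\<bar> < \<epsilon> * l ^ m"
    using uniform_limitD[OF lim] by (fastforce simp: eventually_at_top_linorder)
  show ?thesis
  proof (intro exI[of _ "max 1 (u * R1)"] conjI allI impI ballI)
    fix R x assume R: "R \<ge> max 1 (u * R1)" and x: "x \<in> K"
    obtain \<mu> where \<mu>: "l \<le> \<mu>" "\<mu> \<le> u" "(\<Sum>i\<in>hom_indices \<alpha>. (qh_scale \<alpha> \<mu> x $ i)\<^sup>2) = 1"
    proof (rule qh_scale_to_sphere[where \<delta> = \<delta>' and \<alpha> = \<alpha> and x = x and B = B'])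
      show "\<delta>' \<le> (\<Sum>i\<in>hom_indices \<alpha>. (x $ i)\<^sup>2)" "(\<Sum>i\<in>hom_indices \<alpha>. (x $ i)\<^sup>2) \<le> B'"
        using K(2,3)[OF x] by (auto simp: \<delta>'_def B'_def)
    qed (use \<open>\<delta> > 0\<close> that in \<open>auto simp: \<delta>'_def B'_def l_def u_def\<close>)
    have \<mu>0: "\<mu> > 0" and R0: "R > 0" using \<mu> l R by auto
    define z where "z = qh_scale \<alpha> \<mu> x"
    have "x \<in> U" using x K by blast
    have zS: "z \<in> S" using \<mu>(3) admissible_qh_scale[OF adm \<open>x \<in> U\<close>] by (simp add: S_def z_def)
    have "R1 \<le> R / \<mu>"
    proof (cases "R1 \<le> 0")
      case True
      have "R / \<mu> > 0" using R0 \<mu>0 by simp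
      then show ?thesis using True by linarith
    next
      case False
      then have "\<mu> * R1 \<le> u * R1" using \<mu> by (intro mult_right_mono) auto
      then show ?thesis using R \<mu>0 by (simp add: field_simps)
    qed
    from R1[OF this zS]
    have "\<bar>(f (qh_scale \<alpha> R x) $ j - (R/\<mu>) ^ m * (\<mu> ^ m * fak x $ j)) / (R/\<mu>) ^ m\<bar> < \<epsilon> * l ^ m"
      using \<mu>0 fak[OF \<open>x \<in> U\<close>] by (simp add: z_def qh_scale_qh_scale)
    also have "(f (qh_scale \<alpha> R x) $ j - (R/\<mu>) ^ m * (\<mu> ^ m * fak x $ j)) / (R/\<mu>) ^ m
        = \<mu> ^ m * (f (qh_scale \<alpha> R x) $ j / R ^ m - fak x $ j)"
      using \<mu>0 R0 by (simp add: power_divide field_simps)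
    finally have "\<mu> ^ m * \<bar>f (qh_scale \<alpha> R x) $ j / R ^ m - fak x $ j\<bar> < \<epsilon> * l ^ m"
      using \<mu>0 by (simp add: abs_mult)
    also have "\<dots> \<le> \<mu> ^ m * \<epsilon>" using \<mu> l \<epsilon> by (simp add: mult.commute power_mono)
    finally show "\<bar>f (qh_scale \<alpha> R x) $ j / R ^ (k + \<alpha> j) - fak x $ j\<bar> < \<epsilon>"
      using \<mu>0 by (simp add: m_def)
  qed simp
qed

section \<open>The two compactifications\<close>

locale directional_and_qP =
  fixes \<alpha> \<beta> :: "'n::finite \<Rightarrow> nat" and a :: "'n \<Rightarrow> real" and c k :: nat
    and U :: "(real^'n) set" and f fak :: "real^'n \<Rightarrow> real^'n"
    and i0 :: 'n and M :: "'m::euclidean_space set"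
    and atlas :: "((real^'n) set \<times> (real^'n \<Rightarrow> 'm)) set"
    and h :: "'m \<Rightarrow> real^'n" and V :: "(real^'n) set" and Th :: "real^'n \<Rightarrow> real \<times> 'm"
  assumes asym: "asymptotically_quasi_homogeneous \<alpha> k U f fak"
    and weights: "compactification_weights \<alpha> \<beta> a c"
    and dir: "directional_compactification i0 \<alpha> \<beta> a c U M atlas h V Th"
begin

abbreviation "hs \<equiv> hsum \<alpha> \<beta> a"
abbreviation "ft \<equiv> ftilde \<alpha> \<beta> a c k f fak"

lemma c_pos: "c > 0" and a_ge: "a i \<ge> 1" and \<alpha>\<beta>: "i \<in> hom_indices \<alpha> \<Longrightarrow> \<alpha> i * \<beta> i = c"
  using weights by (auto simp: compactification_weights_def)

lemma \<beta>_pos: "i \<in> hom_indices \<alpha> \<Longrightarrow> \<beta> i > 0"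
  using \<alpha>\<beta>[of i] c_pos by (auto intro!: Nat.gr0I)

lemma \<beta>_eq: "i \<in> hom_indices \<alpha> \<Longrightarrow> real (\<alpha> i) * real (\<beta> i) = real c"
  using \<alpha>\<beta>[of i] by (metis of_nat_mult)

lemma hs_nonneg: "hs x \<ge> 0"
  unfolding hsum_def using a_ge by (intro sum_nonneg mult_nonneg_nonneg) (auto intro: order_trans[of 0 1])

lemma hs_qh_scale: "hs (qh_scale \<alpha> R x) = R ^ (2 * c) * hs x"
  unfolding hsum_def sum_distrib_left
proof (rule sum.cong)
  fix i assume i: "i \<in> hom_indices \<alpha>"
  have "(R ^ \<alpha> i * x $ i) ^ (2 * \<beta> i) = R ^ (2 * (\<alpha> i * \<beta> i)) * (x $ i) ^ (2 * \<beta> i)"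
    by (simp add: power_mult_distrib power_mult[symmetric] mult.left_commute)
  then show "a i * (qh_scale \<alpha> R x $ i) ^ (2 * \<beta> i) = R ^ (2 * c) * (a i * (x $ i) ^ (2 * \<beta> i))"
    using \<alpha>\<beta>[OF i] by simp
qed simp

lemma cont_hs: "continuous_on S hs"
  unfolding hsum_def by (intro continuous_intros)

lemma Isq_pos:
  assumes "hs x > 0" shows "(\<Sum>i\<in>hom_indices \<alpha>. (x $ i)\<^sup>2) > 0"
proof (rule ccontr)
  assume "\<not> ?thesis"
  then have "(\<Sum>i\<in>hom_indices \<alpha>. (x $ i)\<^sup>2) = 0" by (simp add: sum_nonneg antisym not_less)
  then have "\<forall>i\<in>hom_indices \<alpha>. x $ i = 0" by (subst (asm) sum_nonneg_eq_0_iff) auto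
  then have "hs x = 0" unfolding hsum_def using \<beta>_pos by (intro sum.neutral) auto
  then show False using assms by simp
qed

lemma pfun_less_1: "pfun \<alpha> \<beta> a c x < 1 \<longleftrightarrow> hs x < 1"
  and pfun_eq_1: "pfun \<alpha> \<beta> a c x = 1 \<longleftrightarrow> hs x = 1"
  using c_pos by (auto simp: pfun_def)

lemma fak_scale: "x \<in> U \<Longrightarrow> fak (qh_scale \<alpha> R x) $ j = R ^ (k + \<alpha> j) * fak x $ j"
  using asym by (auto simp: asymptotically_quasi_homogeneous_def quasi_homogeneous_field_def quasi_homogeneous_def)

lemma VU: "V \<subseteq> U" and V_open: "open V" and cont_h: "continuous_on M h"
  and ThV: "bij_betw Th V ({0<..} \<times> M)" and Th_smooth: "smooth_map V ({0<..} \<times> M) Th"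
  and y_eq: "y \<in> V \<Longrightarrow> y = dir_point \<alpha> h (fst (Th y)) (snd (Th y))"
  and h_smooth: "smooth_map M UNIV h"
  and hs_h_pos: "\<theta> \<in> M \<Longrightarrow> hs (h \<theta>) > 0"
  using dir unfolding directional_compactification_def diffeomorphism_def
  by (auto intro: smooth_map_imp_continuous_on less_le_trans)

text \<open>As \<open>Th\<close> is onto, \<open>V\<close> contains every \<open>dir_point \<alpha> h s \<theta>\<close> with \<open>s > 0\<close> and is therefore invariant under the
  positive scalings. This is why \<open>Th\<close>, given only on the original phase space, can also be
  evaluated at points of the compactified one.\<close>

lemma dir_point_V:
  assumes "s > 0" "\<theta> \<in> M"
  shows "dir_point \<alpha> h s \<theta> \<in> V" "Th (dir_point \<alpha> h s \<theta>) = (s, \<theta>)"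
proof -
  obtain y where y: "y \<in> V" "Th y = (s, \<theta>)"
    using ThV assms unfolding bij_betw_def by (metis SigmaI greaterThan_iff imageE)
  then have "y = dir_point \<alpha> h s \<theta>" using y_eq[OF y(1)] by simp
  then show "dir_point \<alpha> h s \<theta> \<in> V" "Th (dir_point \<alpha> h s \<theta>) = (s, \<theta>)" using y by auto
qed

lemma h_V: "\<theta> \<in> M \<Longrightarrow> h \<theta> \<in> V"
  using dir_point_V(1)[of 1 \<theta>] by (simp add: dir_point_eq_qh_scale)

lemma Th_V: "y \<in> V \<Longrightarrow> fst (Th y) > 0" "y \<in> V \<Longrightarrow> snd (Th y) \<in> M"
proof -
  assume "y \<in> V"
  then have "Th y \<in> {0<..} \<times> M" using ThV by (auto simp: bij_betw_def)
  then show "fst (Th y) > 0" "snd (Th y) \<in> M" by (auto simp: mem_Times_iff)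
qed

lemma cont_Th: "continuous_on V Th"
  using Th_smooth by (rule smooth_map_imp_continuous_on)

lemma cont_fak: "continuous_on V fak"
  using asym VU by (auto simp: asymptotically_quasi_homogeneous_def quasi_homogeneous_field_def
      intro: smooth_on_imp_continuous_on continuous_on_subset)

text \<open>The limit in the definition of \<open>fhat\<close> exists, since \<open>dir_point \<alpha> h r \<theta>\<close> is \<open>h \<theta>\<close> scaled by \<open>1 / r\<close>.\<close>

lemma fhat_0:
  assumes "\<theta> \<in> M" shows "fhat \<alpha> k f h 0 \<theta> $ j = fak (h \<theta>) $ j"
proof -
  let ?g = "\<lambda>r. r ^ (k + \<alpha> j) * f (dir_point \<alpha> h r \<theta>) $ j"
  have "(?g \<longlongrightarrow> fak (h \<theta>) $ j) (at_right 0)"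
  proof (rule tendstoI)
    fix \<epsilon> :: real assume \<epsilon>: "\<epsilon> > 0"
    have "\<exists>R0>0. \<forall>R\<ge>R0. \<forall>x\<in>{h \<theta>}. \<bar>f (qh_scale \<alpha> R x) $ j / R ^ (k + \<alpha> j) - fak x $ j\<bar> < \<epsilon>"
      by (rule asymptotically_quasi_homogeneous_uniform[OF asym, where B = "\<Sum>i\<in>hom_indices \<alpha>. (h \<theta> $ i)\<^sup>2"
          and \<delta> = "\<Sum>i\<in>hom_indices \<alpha>. (h \<theta> $ i)\<^sup>2"])
        (use h_V VU assms \<epsilon> Isq_pos hs_h_pos in auto)
    then obtain R0 where R0: "R0 > 0"
      "\<And>R. R \<ge> R0 \<Longrightarrow> \<bar>f (qh_scale \<alpha> R (h \<theta>)) $ j / R ^ (k + \<alpha> j) - fak (h \<theta>) $ j\<bar> < \<epsilon>"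
      by blast
    have "dist (?g r) (fak (h \<theta>) $ j) < \<epsilon>" if "0 < r" "r < 1 / R0" for r
    proof -
      have "1 / r \<ge> R0" using that R0(1) by (simp add: field_simps)
      from R0(2)[OF this] show ?thesis
        by (simp add: dist_real_def dir_point_eq_qh_scale power_one_over mult.commute)
    qed
    then show "\<forall>\<^sub>F r in at_right 0. dist (?g r) (fak (h \<theta>) $ j) < \<epsilon>"
      unfolding eventually_at_right_field using R0(1) by (intro exI[of _ "1 / R0"]) auto
  qed
  then show ?thesis by (simp add: fhat_def tendsto_Lim)
qed

text \<open>Near the horizon \<open>kappa_disk\<close> is large, so \<open>ftilde\<close> differs from \<open>fak\<close> by at most \<open>1\<close>, and \<open>fak\<close> is
  continuous.\<close>

lemma ft_locally_bounded:
  assumes x0: "x0 \<in> V" "hs x0 = 1"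
  shows "\<exists>C. \<forall>\<^sub>F x in nhds x0. \<bar>ft x $ j\<bar> \<le> C"
proof -
  let ?Q = "\<lambda>x. \<Sum>i\<in>hom_indices \<alpha>. (x $ i)\<^sup>2"
  have Q0: "?Q x0 > 0" using Isq_pos x0 by simp
  define K where "K = {x\<in>V. ?Q x0 / 2 < ?Q x \<and> ?Q x < ?Q x0 + 1}"
  have "\<exists>R0>0. \<forall>R\<ge>R0. \<forall>x\<in>K. \<bar>f (qh_scale \<alpha> R x) $ j / R ^ (k + \<alpha> j) - fak x $ j\<bar> < 1"
    by (rule asymptotically_quasi_homogeneous_uniform[OF asym, where B = "?Q x0 + 1" and \<delta> = "?Q x0 / 2"])
      (use Q0 VU in \<open>auto simp: K_def\<close>)
  then obtain R0 where R0: "R0 > 0" "\<And>R x. R \<ge> R0 \<Longrightarrow> x \<in> K \<Longrightarrow>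
      \<bar>f (qh_scale \<alpha> R x) $ j / R ^ (k + \<alpha> j) - fak x $ j\<bar> < 1"
    by blast
  have ev_V: "\<forall>\<^sub>F x in nhds x0. x \<in> V"
    using V_open x0 by (simp add: eventually_nhds_in_open)
  have tQ: "(?Q \<longlongrightarrow> ?Q x0) (nhds x0)"
    by (intro tendsto_intros filterlim_ident)
  have th: "(hs \<longlongrightarrow> hs x0) (nhds x0)"
    unfolding hsum_def by (intro tendsto_intros filterlim_ident)
  have "(fak \<longlongrightarrow> fak x0) (nhds x0)"
    using cont_fak x0 V_open by (simp add: continuous_on_eq_continuous_at isCont_def tendsto_nhds_iff)
  then have tf: "((\<lambda>x. \<bar>fak x $ j\<bar>) \<longlongrightarrow> \<bar>fak x0 $ j\<bar>) (nhds x0)"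
    by (intro tendsto_intros)
  have "\<forall>\<^sub>F x in nhds x0. ?Q x0 / 2 < ?Q x" "\<forall>\<^sub>F x in nhds x0. ?Q x < ?Q x0 + 1"
    using Q0 by (auto intro: order_tendstoD[OF tQ] simp del: less_divide_eq_numeral1 divide_less_eq_numeral1)
  moreover have "\<forall>\<^sub>F x in nhds x0. 1 - 1 / R0 ^ (2 * c) < hs x"
    using order_tendstoD(1)[OF th, of "1 - 1 / R0 ^ (2 * c)"] x0 R0(1) by simp
  moreover have "\<forall>\<^sub>F x in nhds x0. \<bar>fak x $ j\<bar> < \<bar>fak x0 $ j\<bar> + 1"
    using order_tendstoD(2)[OF tf] by simp
  ultimately have "\<forall>\<^sub>F x in nhds x0. \<bar>ft x $ j\<bar> \<le> \<bar>fak x0 $ j\<bar> + 2"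
    using ev_V
  proof eventually_elim
    case (elim x)
    then have xK: "x \<in> K" by (simp add: K_def)
    show ?case
    proof (cases "hs x < 1")
      case True
      have "kappa_disk \<alpha> \<beta> a c x \<ge> R0"
      proof -
        have "1 - hs x \<le> (1 / R0) ^ (2 * c)" using elim by (simp add: power_one_over)
        then have "root (2 * c) (1 - hs x) \<le> root (2 * c) ((1 / R0) ^ (2 * c))"
          using c_pos by (intro real_root_le_mono) auto
        also have "\<dots> = 1 / R0" using c_pos R0 by (intro real_root_power_cancel) auto
        finally have "root (2 * c) (1 - hs x) * R0 \<le> 1" using R0 by (simp add: field_simps)
        moreover have "root (2 * c) (1 - hs x) > 0" using True c_pos by simp
        ultimately show ?thesis by (simp add: kappa_disk_def field_simps)
      qed
      from R0(2)[OF this xK] have "\<bar>ft x $ j - fak x $ j\<bar> < 1"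
        using True by (simp add: ftilde_def pfun_less_1)
      then show ?thesis using elim by linarith
    next
      case False
      then have "ft x = fak x" by (simp add: ftilde_def pfun_less_1)
      then show ?thesis using elim by simp
    qed
  qed
  then show ?thesis by blast
qed

section \<open>The extended change of coordinates\<close>

text \<open>\<open>rho\<close> is the quotient of the two scalings: \<open>rho s \<theta> = s * \<kappa>(y)\<close> when \<open>y\<close> has directional coordinates
  \<open>(s, \<theta>)\<close>. Unlike \<open>\<kappa>\<close> it stays finite and positive at \<open>s = 0\<close>.\<close>

definition rho where "rho s \<theta> = root (2 * c) (s ^ (2 * c) + hs (h \<theta>))"

text \<open>The change of coordinates \<open>(s, \<theta>) \<mapsto> x\<close>, written as a directional point so that \<open>Th\<close> can be applied to
  its values. \<open>Psi\<close> below is its inverse: \<open>Th x = (\<rho>, \<theta>)\<close>, and \<open>s\<close> is obtained by solving the equation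
  that defines \<open>\<rho>\<close>.\<close>

definition Phi where "Phi z = dir_point \<alpha> h (rho (fst z) (snd z)) (snd z)"
definition Psi where
  "Psi x = (root (2 * c) (fst (Th x) ^ (2 * c) - hs (h (snd (Th x)))), snd (Th x))"
definition qP_region where "qP_region = {x\<in>V. hs x \<le> 1}"

lemma rho_arg_pos: "\<theta> \<in> M \<Longrightarrow> s ^ (2 * c) + hs (h \<theta>) > 0"
  using hs_h_pos[of \<theta>] zero_le_even_power'[of s c] by linarith

lemma rho_pos: "\<theta> \<in> M \<Longrightarrow> rho s \<theta> > 0"
  using rho_arg_pos[of \<theta> s] c_pos by (simp add: rho_def)

lemma rho_power: "\<theta> \<in> M \<Longrightarrow> rho s \<theta> ^ (2 * c) = s ^ (2 * c) + hs (h \<theta>)"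
  using rho_arg_pos[of \<theta> s] c_pos by (simp add: rho_def)

lemma Phi_V: "z \<in> {0..} \<times> M \<Longrightarrow> Phi z \<in> V"
  and Th_Phi: "z \<in> {0..} \<times> M \<Longrightarrow> Th (Phi z) = (rho (fst z) (snd z), snd z)"
  using dir_point_V rho_pos by (auto simp: Phi_def)

lemma hs_dir_point: "hs (dir_point \<alpha> h r \<theta>) = hs (h \<theta>) / r ^ (2 * c)"
  by (simp add: dir_point_eq_qh_scale hs_qh_scale power_one_over)

lemma hs_Phi:
  assumes "z \<in> {0..} \<times> M"
  shows "hs (Phi z) = 1 - (fst z / rho (fst z) (snd z)) ^ (2 * c)"
proof -
  define R where "R = rho (fst z) (snd z) ^ (2 * c)"
  have "snd z \<in> M" using assms by auto
  then have "R = fst z ^ (2 * c) + hs (h (snd z))" "R > 0"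
    unfolding R_def by (rule rho_power, intro zero_less_power rho_pos)
  then have "R > 0" "hs (h (snd z)) = R - fst z ^ (2 * c)" by auto
  then show ?thesis
    by (simp add: Phi_def hs_dir_point power_divide R_def[symmetric] diff_divide_distrib)
qed

lemma Phi_D: "z \<in> {0..} \<times> M \<Longrightarrow> Phi z \<in> qP_region"
  using Phi_V[of z] hs_Phi[of z] by (simp add: qP_region_def)

lemma Psi_Phi: "z \<in> {0..} \<times> M \<Longrightarrow> Psi (Phi z) = z"
  using rho_power[of "snd z" "fst z"] c_pos
  by (auto simp: Psi_def Th_Phi intro!: real_root_power_cancel)

lemma
  assumes "x \<in> qP_region"
  shows Psi_in: "Psi x \<in> {0..} \<times> M" and Phi_Psi: "Phi (Psi x) = x"
    and rho_Psi: "rho (fst (Psi x)) (snd (Psi x)) = fst (Th x)"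
    and fst_Psi: "fst (Psi x) = fst (Th x) * root (2 * c) (1 - hs x)"
proof -
  define r \<theta> where "r = fst (Th x)" and "\<theta> = snd (Th x)"
  have x: "x \<in> V" "hs x \<le> 1" using assms by (auto simp: qP_region_def)
  have r: "r > 0" "\<theta> \<in> M" using Th_V[OF x(1)] by (auto simp: r_def \<theta>_def)
  have xe: "x = dir_point \<alpha> h r \<theta>" using y_eq[OF x(1)] by (simp add: r_def \<theta>_def)
  have hx: "hs x * r ^ (2 * c) = hs (h \<theta>)" using r by (simp add: xe hs_dir_point)
  have "hs x * r ^ (2 * c) \<le> 1 * r ^ (2 * c)" using x r by (intro mult_right_mono) auto
  then have nn: "r ^ (2 * c) - hs (h \<theta>) \<ge> 0" using hx by simp
  have Psi: "Psi x = (root (2 * c) (r ^ (2 * c) - hs (h \<theta>)), \<theta>)"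
    by (simp add: Psi_def r_def \<theta>_def)
  show "Psi x \<in> {0..} \<times> M" using nn c_pos r by (simp add: Psi)
  have "root (2 * c) (r ^ (2 * c)) = r" using r c_pos by (intro real_root_power_cancel) auto
  then have rho: "rho (fst (Psi x)) (snd (Psi x)) = r"
    using nn c_pos by (simp add: Psi rho_def)
  then show "rho (fst (Psi x)) (snd (Psi x)) = fst (Th x)" by (simp add: r_def)
  show "Phi (Psi x) = x" unfolding Phi_def rho by (simp add: Psi flip: xe)
  have eq: "r ^ (2 * c) - hs (h \<theta>) = r ^ (2 * c) * (1 - hs x)" using hx by (simp add: algebra_simps)
  have "fst (Psi x) = root (2 * c) (r ^ (2 * c)) * root (2 * c) (1 - hs x)"
    unfolding Psi fst_conv eq real_root_mult ..
  then show "fst (Psi x) = fst (Th x) * root (2 * c) (1 - hs x)"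
    using \<open>root (2 * c) (r ^ (2 * c)) = r\<close> by (simp add: r_def)
qed

lemma Phi_image: "Phi ` ({0..} \<times> M) = qP_region"
proof
  show "Phi ` ({0..} \<times> M) \<subseteq> qP_region" using Phi_D by blast
  show "qP_region \<subseteq> Phi ` ({0..} \<times> M)"
  proof
    fix x assume "x \<in> qP_region"
    then show "x \<in> Phi ` ({0..} \<times> M)" using image_eqI[OF _ Psi_in, of x Phi] Phi_Psi by simp
  qed
qed

lemma cont_rho: "continuous_on (UNIV \<times> M) (\<lambda>z. rho (fst z) (snd z))"
proof -
  have "continuous_on (UNIV \<times> M) (\<lambda>z::real \<times> 'm. hs (h (snd z)))"
    by (rule continuous_on_compose2[OF cont_hs[of UNIV]])
      (auto intro!: continuous_on_compose2[OF cont_h] continuous_intros)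
  then show ?thesis
    unfolding rho_def by (intro continuous_intros)
qed

lemma Phi_homeomorphism: "homeomorphism ({0..} \<times> M) qP_region Phi Psi"
proof (rule homeomorphismI)
  have "continuous_on ({0..} \<times> M) (\<lambda>z. rho (fst z) (snd z))"
    using cont_rho by (rule continuous_on_subset) auto
  moreover have "continuous_on ({0..} \<times> M) (\<lambda>z::real \<times> 'm. h (snd z))"
    by (auto intro!: continuous_on_compose2[OF cont_h] continuous_intros)
  ultimately show "continuous_on ({0..} \<times> M) Phi"
    unfolding Phi_def dir_point_def using rho_pos
    by (intro continuous_intros) (auto simp: less_imp_neq[symmetric] mem_Times_iff)
  have Th: "continuous_on qP_region Th" using cont_Th by (rule continuous_on_subset) (auto simp: qP_region_def)
  have "continuous_on qP_region (\<lambda>x. h (snd (Th x)))"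
    by (rule continuous_on_compose2[OF cont_h continuous_on_snd[OF Th]]) (auto intro: Th_V simp: qP_region_def)
  then have "continuous_on qP_region (\<lambda>x. hs (h (snd (Th x))))"
    by (rule continuous_on_compose2[OF cont_hs[of UNIV]]) auto
  then show "continuous_on qP_region Psi"
    unfolding Psi_def using Th by (intro continuous_intros)
  show "Phi ` ({0..} \<times> M) \<subseteq> qP_region" "Psi ` qP_region \<subseteq> {0..} \<times> M"
    using Phi_D Psi_in by blast+
qed (use Psi_Phi Phi_Psi in blast)+

lemma Phi_eq_TqP:
  assumes "s > 0" "\<theta> \<in> M"
  shows "Phi (s, \<theta>) = TqP \<alpha> \<beta> a c (dir_point \<alpha> h s \<theta>)"
proof -
  let ?y = "dir_point \<alpha> h s \<theta>"
  have "pfun \<alpha> \<beta> a c ?y ^ (2 * c) = hs ?y"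
    using c_pos hs_nonneg by (simp add: pfun_def)
  then have "1 + pfun \<alpha> \<beta> a c ?y ^ (2 * c) = (s ^ (2 * c) + hs (h \<theta>)) / s ^ (2 * c)"
    using assms by (simp add: hs_dir_point field_simps)
  moreover have "root (2 * c) (s ^ (2 * c)) = s" using assms c_pos by (intro real_root_power_cancel) auto
  ultimately have "kappa \<alpha> \<beta> a c ?y = rho s \<theta> / s"
    by (simp add: kappa_def rho_def real_root_divide)
  then show ?thesis
    using assms rho_pos[of \<theta> s] by (simp add: Phi_def TqP_def vec_eq_iff dir_point_def power_divide)
qed

text \<open>For \<open>s > 0\<close> both sides evaluate \<open>f\<close> at the same point \<open>y\<close>, with \<open>\<kappa>(y) = \<rho> / s\<close>. For \<open>s = 0\<close> both are values of
  \<open>fak\<close>, which is quasi-homogeneous.\<close>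

lemma fhat_eq_ft:
  assumes z: "s \<ge> 0" "\<theta> \<in> M"
  shows "fhat \<alpha> k f h s \<theta> $ j = rho s \<theta> ^ (k + \<alpha> j) * ft (Phi (s, \<theta>)) $ j"
proof -
  let ?x = "Phi (s, \<theta>)"
  have \<rho>: "rho s \<theta> > 0" using rho_pos z by simp
  have hx: "hs ?x = 1 - (s / rho s \<theta>) ^ (2 * c)" using hs_Phi[of "(s, \<theta>)"] z by simp
  have xe: "?x = qh_scale \<alpha> (1 / rho s \<theta>) (h \<theta>)" by (simp add: Phi_def dir_point_eq_qh_scale)
  show ?thesis
  proof (cases "s = 0")
    case True
    then have "hs ?x = 1" using hx c_pos by simp
    then have "ft ?x = fak ?x" by (simp add: ftilde_def pfun_less_1)
    then have "ft ?x $ j = (1 / rho s \<theta>) ^ (k + \<alpha> j) * fak (h \<theta>) $ j"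
      using fak_scale h_V[OF z(2)] VU by (auto simp: xe)
    then show ?thesis using True fhat_0[OF z(2)] \<rho> by (simp add: power_one_over)
  next
    case False
    then have s: "s > 0" using z by simp
    then have "(s / rho s \<theta>) ^ (2 * c) > 0" using \<rho> by simp
    then have "hs ?x < 1" using hx by simp
    moreover have "kappa_disk \<alpha> \<beta> a c ?x = rho s \<theta> / s"
      using real_root_power_cancel[of "2 * c" "s / rho s \<theta>"] c_pos s \<rho>
      by (simp add: kappa_disk_def hx)
    moreover have "qh_scale \<alpha> (rho s \<theta> / s) ?x = dir_point \<alpha> h s \<theta>"
      using \<rho> by (simp add: xe qh_scale_qh_scale dir_point_eq_qh_scale)
    ultimately have "ft ?x $ j = f (dir_point \<alpha> h s \<theta>) $ j / (rho s \<theta> / s) ^ (k + \<alpha> j)"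
      by (simp add: ftilde_def pfun_less_1)
    then show ?thesis using s \<rho> by (simp add: fhat_def power_divide)
  qed
qed

lemma chart:
  assumes "(P, \<xi>) \<in> atlas"
  shows chart_open: "openin (top_of_set {v. v $ i0 = 0}) P" "openin (top_of_set M) (\<xi> ` P)"
    and chart_sub: "\<xi> ` P \<subseteq> M"
    and chart_smooth: "smooth_map P (\<xi> ` P) \<xi>" "smooth_map (\<xi> ` P) P (inv_into P \<xi>)"
    and chart_inv: "u \<in> P \<Longrightarrow> invertible (dir_matrix i0 \<alpha> h \<xi> u)"
proof -
  have man: "smooth_manifold i0 M atlas"
    using dir by (simp add: directional_compactification_def)
  then have "local_parametrization i0 M P \<xi>"
    using assms by (auto simp: smooth_manifold_def)
  then show "openin (top_of_set {v. v $ i0 = 0}) P" "openin (top_of_set M) (\<xi> ` P)"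
    "smooth_map P (\<xi> ` P) \<xi>" "smooth_map (\<xi> ` P) P (inv_into P \<xi>)"
    by (auto simp: local_parametrization_def diffeomorphism_def bij_betw_def)
  show "\<xi> ` P \<subseteq> M" using man assms by (force simp: smooth_manifold_def)
  show "invertible (dir_matrix i0 \<alpha> h \<xi> u)" if "u \<in> P"
    using dir assms that by (force simp: directional_compactification_def)
qed

lemma chart_exists:
  assumes "\<theta> \<in> M" shows "\<exists>P \<xi>. (P, \<xi>) \<in> atlas \<and> \<theta> \<in> \<xi> ` P"
proof -
  have "M = (\<Union>(P, \<xi>)\<in>atlas. \<xi> ` P)"
    using dir unfolding directional_compactification_def smooth_manifold_def by blast
  with assms have "\<theta> \<in> (\<Union>(P, \<xi>)\<in>atlas. \<xi> ` P)" by (rule subst[rotated])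
  then show ?thesis by blast
qed

text \<open>The chain rule in the local parametrization. The entries of \<open>dir_matrix\<close> are partial derivatives along
  the hyperplane of the \<open>\<theta>\<close>'s; they are the columns of the derivative of a smooth extension \<open>E\<close> of
  \<open>h \<circ> \<xi>\<close>, and \<open>v'\<close> has no component transversal to the hyperplane.\<close>

lemma h_chart_velocity:
  assumes at: "(P, \<xi>) \<in> atlas" and ev: "\<forall>\<^sub>F r in nhds t. v r \<in> P"
    and dv: "(v has_vector_derivative v') (at t)"
  shows "((\<lambda>r. h (\<xi> (v r)) $ i) has_real_derivative
    (\<Sum>j\<in>-{i0}. dir_matrix i0 \<alpha> h \<xi> (v t) $ i $ j * v' $ j)) (at t)"
proof -
  define u where "u = v t"
  have u: "u \<in> P" using eventually_nhds_x_imp_x[OF ev] by (simp add: u_def)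
  obtain W F F' where W: "open W" "u \<in> W" and F': "(F has_derivative F') (at u)"
    and F: "\<forall>z\<in>W \<inter> P. F z = \<xi> z"
    using smooth_map_local_derivative[OF chart_smooth(1)[OF at] u] by blast
  have "\<xi> u \<in> M" using chart_sub[OF at] u by blast
  then obtain W' G G' where W': "open W'" "\<xi> u \<in> W'" and G0: "(G has_derivative G') (at (\<xi> u))"
    and G: "\<forall>z\<in>W' \<inter> M. G z = h z"
    using smooth_map_local_derivative[OF h_smooth] by blast
  have Fu: "F u = \<xi> u" using F W u by simp
  have G': "(G has_derivative G') (at (F u))" using G0 by (simp add: Fu)
  define E E' where "E z = G (F z)" and "E' z = G' (F' z)" for z
  have dE: "(E has_derivative E') (at u)"
    using diff_chain_at[OF F' G'] by (simp add: E_def[abs_def] E'_def[abs_def] o_def)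
  have linE: "linear E'" using dE has_derivative_linear by blast
  have contF: "(F \<longlongrightarrow> F u) (nhds u)"
    using has_derivative_continuous[OF F'] by (simp add: isCont_def tendsto_nhds_iff)
  have "\<forall>\<^sub>F z in nhds u. F z \<in> W'" using topological_tendstoD[OF contF W'(1)] W' Fu by simp
  moreover have "\<forall>\<^sub>F z in nhds u. z \<in> W" using W by (simp add: eventually_nhds_in_open)
  ultimately have hE: "\<forall>\<^sub>F z in nhds u. z \<in> P \<longrightarrow> h (\<xi> z) = E z"
  proof eventually_elim
    case (elim z)
    show ?case
    proof
      assume "z \<in> P"
      then have "F z = \<xi> z" "\<xi> z \<in> M" using elim F chart_sub[OF at] by auto
      then show "h (\<xi> z) = E z" using elim G by (simp add: E_def)
    qed
  qed
  have column: "dir_matrix i0 \<alpha> h \<xi> u $ i $ j = E' (axis j 1) $ i" if "j \<noteq> i0" for j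
  proof -
    let ?p = "\<lambda>s. u + s *\<^sub>R axis j (1::real)"
    obtain T where T: "open T" "P = {v. v $ i0 = 0} \<inter> T"
      using chart_open(1)[OF at] unfolding openin_open by blast
    have p: "(?p \<longlongrightarrow> u) (nhds 0)"
    proof -
      have "(?p \<longlongrightarrow> u + 0 *\<^sub>R axis j 1) (nhds 0)" by (intro tendsto_intros filterlim_ident)
      then show ?thesis by simp
    qed
    have "\<forall>\<^sub>F s in nhds 0. ?p s \<in> T" using topological_tendstoD[OF p T(1)] T u by blast
    moreover have "?p s $ i0 = 0" for s using u T(2) that by (simp add: axis_def)
    ultimately have "\<forall>\<^sub>F s in nhds 0. ?p s \<in> P" by (simp add: T(2))
    moreover have "\<forall>\<^sub>F s in nhds 0. ?p s \<in> P \<longrightarrow> h (\<xi> (?p s)) = E (?p s)"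
      using p hE by (rule eventually_compose_filterlim[rotated])
    ultimately have eq: "\<forall>\<^sub>F s in nhds 0. h (\<xi> (?p s)) $ i = E (?p s) $ i"
      by eventually_elim simp
    have "(?p has_vector_derivative axis j 1) (at 0)"
      by (auto intro!: derivative_eq_intros)
    then have "((\<lambda>s. E (?p s)) has_vector_derivative E' (axis j 1)) (at 0)"
      using vector_derivative_diff_chain_within[of ?p "axis j 1" 0 UNIV E E'] dE
      by (simp add: o_def has_derivative_at_withinI)
    then have "((\<lambda>s. E (?p s) $ i) has_real_derivative E' (axis j 1) $ i) (at 0)"
      unfolding has_vector_derivative_vec_iff by blast
    then have "((\<lambda>s. h (\<xi> (?p s)) $ i) has_real_derivative E' (axis j 1) $ i) (at 0)"
      using DERIV_cong_ev[OF refl eq refl] by simp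
    then show ?thesis using that by (simp add: dir_matrix_def DERIV_imp_deriv)
  qed
  have contv: "(v \<longlongrightarrow> u) (nhds t)"
    using has_vector_derivative_continuous[OF dv] by (simp add: isCont_def tendsto_nhds_iff u_def)
  have v0: "v' $ i0 = 0"
  proof -
    have "\<forall>\<^sub>F r in nhds t. v r $ i0 = 0"
      using ev by eventually_elim (use openin_imp_subset[OF chart_open(1)[OF at]] in blast)
    then have "((\<lambda>r. v r $ i0) has_real_derivative 0) (at t)"
      using DERIV_cong_ev[of t t "\<lambda>r. v r $ i0" "\<lambda>_. 0" 0 0] by simp
    then show ?thesis
      using dv unfolding has_vector_derivative_vec_iff by (metis DERIV_unique)
  qed
  have "\<forall>\<^sub>F r in nhds t. v r \<in> P \<longrightarrow> h (\<xi> (v r)) = E (v r)"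
    using contv hE by (rule eventually_compose_filterlim[rotated])
  with ev have eq: "\<forall>\<^sub>F r in nhds t. h (\<xi> (v r)) $ i = E (v r) $ i"
    by eventually_elim simp
  have "((\<lambda>r. E (v r)) has_vector_derivative E' v') (at t)"
    using vector_derivative_diff_chain_within[OF dv, of E E'] dE
    by (simp add: o_def has_derivative_at_withinI u_def)
  then have "((\<lambda>r. E (v r) $ i) has_real_derivative E' v' $ i) (at t)"
    unfolding has_vector_derivative_vec_iff by blast
  then have "((\<lambda>r. h (\<xi> (v r)) $ i) has_real_derivative E' v' $ i) (at t)"
    using DERIV_cong_ev[OF refl eq refl] by simp
  moreover have "E' v' $ i = (\<Sum>j\<in>-{i0}. dir_matrix i0 \<alpha> h \<xi> u $ i $ j * v' $ j)"
  proof -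
    have "E' v' = E' (\<Sum>j\<in>UNIV. v' $ j *\<^sub>R axis j 1)"
      using basis_expansion[of v'] by (simp add: scalar_mult_eq_scaleR)
    also have "\<dots> = (\<Sum>j\<in>UNIV. v' $ j *\<^sub>R E' (axis j 1))"
      by (simp add: linear_sum[OF linE] linear_scale[OF linE])
    finally have "E' v' $ i = (\<Sum>j\<in>UNIV. v' $ j * E' (axis j 1) $ i)" by simp
    also have "\<dots> = (\<Sum>j\<in>-{i0}. v' $ j * E' (axis j 1) $ i)"
      by (rule sum.mono_neutral_right) (auto simp: v0)
    also have "\<dots> = (\<Sum>j\<in>-{i0}. dir_matrix i0 \<alpha> h \<xi> u $ i $ j * v' $ j)"
      by (rule sum.cong) (auto simp: column)
    finally show ?thesis .
  qed
  ultimately show ?thesis by (simp add: u_def)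
qed

text \<open>Differentiating \<open>h\<^sub>i / \<rho>^\<alpha>\<^sub>i\<close> gives \<open>\<rho>^(-\<alpha>\<^sub>i) (h\<^sub>i' - \<alpha>\<^sub>i h\<^sub>i \<rho>'/\<rho>)\<close>, and \<open>(\<alpha>\<^sub>i h\<^sub>i)\<^sub>i\<close> is the column \<open>i0\<close>. The
  matrix \<open>A\<close> is thus, up to a diagonal factor, the Jacobian matrix of the point with respect to
  \<open>(ln (1/\<rho>), \<theta>)\<close>.\<close>

lemma dir_point_velocity:
  assumes at: "(P, \<xi>) \<in> atlas" and ev: "\<forall>\<^sub>F r in nhds t. v r \<in> P"
    and dv: "(v has_vector_derivative v') (at t)"
    and d\<rho>: "(\<rho> has_real_derivative \<rho>') (at t)" "\<rho> t > 0"
  shows "((\<lambda>r. dir_point \<alpha> h (\<rho> r) (\<xi> (v r)) $ i) has_real_derivative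
    (dir_matrix i0 \<alpha> h \<xi> (v t) *v (\<chi> j. if j = i0 then - \<rho>' / \<rho> t else v' $ j)) $ i / \<rho> t ^ \<alpha> i) (at t)"
proof -
  let ?A = "dir_matrix i0 \<alpha> h \<xi> (v t)"
  let ?s = "\<Sum>j\<in>-{i0}. ?A $ i $ j * v' $ j"
  have "(?A *v (\<chi> j. if j = i0 then - \<rho>' / \<rho> t else v' $ j)) $ i
      = ?A $ i $ i0 * (- \<rho>' / \<rho> t) + (\<Sum>j\<in>UNIV - {i0}. ?A $ i $ j * v' $ j)"
    unfolding matrix_vector_mult_def by (simp add: sum.remove[of UNIV i0])
  also have "\<dots> = ?s - \<alpha> i * h (\<xi> (v t)) $ i * \<rho>' / \<rho> t"
    by (simp add: Compl_eq_Diff_UNIV dir_matrix_def)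
  finally have A: "(?A *v (\<chi> j. if j = i0 then - \<rho>' / \<rho> t else v' $ j)) $ i
      = ?s - \<alpha> i * h (\<xi> (v t)) $ i * \<rho>' / \<rho> t" .
  have "((\<lambda>r. h (\<xi> (v r)) $ i / \<rho> r ^ \<alpha> i) has_real_derivative
      (?s * \<rho> t ^ \<alpha> i - h (\<xi> (v t)) $ i * (\<alpha> i * \<rho> t ^ (\<alpha> i - 1) * \<rho>')) / (\<rho> t ^ \<alpha> i * \<rho> t ^ \<alpha> i)) (at t)"
    using h_chart_velocity[OF at ev dv, of i] d\<rho> by (auto intro!: derivative_eq_intros simp: mult_ac)
  moreover have "(?s * \<rho> t ^ \<alpha> i - h (\<xi> (v t)) $ i * (\<alpha> i * \<rho> t ^ (\<alpha> i - 1) * \<rho>')) / (\<rho> t ^ \<alpha> i * \<rho> t ^ \<alpha> i)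
      = (?s - \<alpha> i * h (\<xi> (v t)) $ i * \<rho>' / \<rho> t) / \<rho> t ^ \<alpha> i"
    using d\<rho>(2) by (cases "\<alpha> i") (simp_all add: field_simps)
  ultimately show ?thesis by (simp add: dir_point_def A)
qed

section \<open>Velocities in the two coordinate systems\<close>

abbreviation "g \<equiv> qP_field \<alpha> \<beta> a c k f fak"

text \<open>Half the directional derivative of \<open>hsum\<close> along \<open>ftilde\<close>; in \<open>g\<close> it is the coefficient of the radial
  correction that makes the field tangent to the horizon. It is the \<open>S\<close> of the equation \<open>w' = -2 S w\<close>.\<close>

definition radial_sum where
  "radial_sum x = (\<Sum>j\<in>hom_indices \<alpha>. real (\<beta> j) * a j * (x $ j) ^ (2 * \<beta> j - 1) * ft x $ j)"

text \<open>As \<open>1 / \<beta> i = \<alpha> i / c\<close> on \<open>hom_indices \<alpha>\<close> and \<open>\<alpha> i = 0\<close> outside, one formula covers both cases of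
  the definition.\<close>

lemma qP_field_nth: "g x $ i = ft x $ i - \<alpha> i * x $ i * (radial_sum x / c)"
proof (cases "i \<in> hom_indices \<alpha>")
  case True
  then have "1 / real (\<beta> i) = \<alpha> i / c"
    using \<beta>_eq[OF True] \<beta>_pos[OF True] c_pos by (simp add: field_simps)
  then have "x $ i / real (\<beta> i) = \<alpha> i / c * x $ i" by (metis divide_inverse inverse_eq_divide mult.commute)
  then show ?thesis using True by (simp add: qP_field_def Let_def radial_sum_def)
next
  case False
  then show ?thesis by (simp add: qP_field_def Let_def hom_indices_def)
qed

text \<open>The vector \<open>(\<alpha>\<^sub>i x\<^sub>i)\<^sub>i\<close> generates the scaling \<open>qh_scale\<close>, under which \<open>hsum\<close> is homogeneous of degree \<open>2 c\<close>;
  Euler's identity accounts for the term with \<open>L\<close>. Both the solutions of \<open>x' = g(x)\<close>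
  (with \<open>m = 1\<close>) and the images of directional solutions (with \<open>m = \<rho>\<^sup>k\<close>) have velocities of this form.\<close>

lemma hs_velocity:
  fixes m L :: real
  assumes dx: "\<And>i. ((\<lambda>r. x r $ i) has_real_derivative m * ft (x t) $ i - \<alpha> i * x t $ i * L) (at t)"
  shows "((\<lambda>r. hs (x r)) has_real_derivative 2 * m * radial_sum (x t) - 2 * c * L * hs (x t)) (at t)"
proof -
  let ?d = "\<lambda>i. m * ft (x t) $ i - \<alpha> i * x t $ i * L"
  have "((\<lambda>r. hs (x r)) has_real_derivative
      (\<Sum>i\<in>hom_indices \<alpha>. a i * (real (2 * \<beta> i) * x t $ i ^ (2 * \<beta> i - 1) * ?d i))) (at t)"
    unfolding hsum_def by (intro DERIV_sum DERIV_cmult) (auto intro!: derivative_eq_intros dx)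
  moreover have "(\<Sum>i\<in>hom_indices \<alpha>. a i * (real (2 * \<beta> i) * x t $ i ^ (2 * \<beta> i - 1) * ?d i))
    = (\<Sum>i\<in>hom_indices \<alpha>. 2 * m * (real (\<beta> i) * a i * (x t $ i) ^ (2 * \<beta> i - 1) * ft (x t) $ i)
        - 2 * c * L * (a i * (x t $ i) ^ (2 * \<beta> i)))"
  proof (rule sum.cong)
    fix i assume i: "i \<in> hom_indices \<alpha>"
    have "2 * \<beta> i = Suc (2 * \<beta> i - 1)" using \<beta>_pos[OF i] by simp
    then have p: "x t $ i ^ (2 * \<beta> i) = x t $ i * x t $ i ^ (2 * \<beta> i - 1)" by (metis power_Suc)
    show "a i * (real (2 * \<beta> i) * x t $ i ^ (2 * \<beta> i - 1) * ?d i)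
      = 2 * m * (real (\<beta> i) * a i * (x t $ i) ^ (2 * \<beta> i - 1) * ft (x t) $ i)
        - 2 * c * L * (a i * (x t $ i) ^ (2 * \<beta> i))"
      unfolding p by (simp add: algebra_simps \<beta>_eq[OF i, symmetric])
  qed simp
  ultimately show ?thesis
    by (simp add: sum_subtractf sum_distrib_left[symmetric] radial_sum_def hsum_def)
qed

lemma radial_sum_locally_bounded:
  assumes x0: "x0 \<in> V" "hs x0 = 1"
  shows "\<exists>C. \<forall>\<^sub>F x in nhds x0. \<bar>radial_sum x\<bar> \<le> C"
proof -
  let ?t = "\<lambda>x j. real (\<beta> j) * a j * (x $ j) ^ (2 * \<beta> j - 1) * ft x $ j"
  have "\<exists>C. \<forall>\<^sub>F x in nhds x0. \<bar>?t x j\<bar> \<le> C" for j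
  proof -
    obtain C where C: "\<forall>\<^sub>F x in nhds x0. \<bar>ft x $ j\<bar> \<le> C" using ft_locally_bounded[OF x0] by blast
    let ?u = "\<lambda>x::real^'n. \<bar>real (\<beta> j) * a j * (x $ j) ^ (2 * \<beta> j - 1)\<bar>"
    have "(?u \<longlongrightarrow> ?u x0) (nhds x0)" by (intro tendsto_intros filterlim_ident)
    then have "\<forall>\<^sub>F x in nhds x0. ?u x < ?u x0 + 1" by (rule order_tendstoD(2)) simp
    with C have "\<forall>\<^sub>F x in nhds x0. \<bar>?t x j\<bar> \<le> (?u x0 + 1) * C"
    proof eventually_elim
      case (elim x)
      have "\<bar>?t x j\<bar> = ?u x * \<bar>ft x $ j\<bar>" by (simp add: abs_mult)
      also have "\<dots> \<le> (?u x0 + 1) * C" using elim by (intro mult_mono) auto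
      finally show ?case .
    qed
    then show ?thesis by blast
  qed
  then have "\<exists>C. \<forall>j. \<forall>\<^sub>F x in nhds x0. \<bar>?t x j\<bar> \<le> C j" by (intro choice allI)
  then obtain C where C: "\<And>j. \<forall>\<^sub>F x in nhds x0. \<bar>?t x j\<bar> \<le> C j" by blast
  have "\<forall>\<^sub>F x in nhds x0. \<forall>j\<in>hom_indices \<alpha>. \<bar>?t x j\<bar> \<le> C j"
    by (intro eventually_ball_finite) (use C in auto)
  then have "\<forall>\<^sub>F x in nhds x0. \<bar>radial_sum x\<bar> \<le> (\<Sum>j\<in>hom_indices \<alpha>. C j)"
  proof eventually_elim
    case (elim x)
    have "\<bar>radial_sum x\<bar> \<le> (\<Sum>j\<in>hom_indices \<alpha>. \<bar>?t x j\<bar>)" unfolding radial_sum_def by (rule sum_abs)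
    also have "\<dots> \<le> (\<Sum>j\<in>hom_indices \<alpha>. C j)" using elim by (intro sum_mono) auto
    finally show ?case .
  qed
  then show ?thesis by blast
qed

lemma hs_velocity_solution:
  assumes "(x has_vector_derivative g (x t)) (at t)"
  shows "((\<lambda>r. 1 - hs (x r)) has_real_derivative - 2 * radial_sum (x t) * (1 - hs (x t))) (at t)"
proof -
  have "((\<lambda>r. hs (x r)) has_real_derivative 2 * 1 * radial_sum (x t) - 2 * c * (radial_sum (x t) / c) * hs (x t)) (at t)"
    by (rule hs_velocity)
      (use assms in \<open>simp only: has_vector_derivative_vec_iff qP_field_nth mult_1\<close>)
  then have "((\<lambda>r. 1 - hs (x r)) has_real_derivative
      0 - (2 * 1 * radial_sum (x t) - 2 * c * (radial_sum (x t) / c) * hs (x t))) (at t)"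
    by (intro DERIV_diff DERIV_const)
  then show ?thesis using c_pos by (simp add: algebra_simps)
qed

text \<open>The linear equation \<open>w' = -2 S w\<close> for \<open>w = 1 - hsum x\<close> has a locally bounded coefficient at the zeros
  of \<open>w\<close>, so \<open>w\<close> vanishes identically if it vanishes once.\<close>

lemma horizon_invariant:
  assumes sol: "solution_in qP_region g J x" and t0: "t0 \<in> J" "hs (x t0) = 1" and t: "t \<in> J"
  shows "hs (x t) = 1"
proof -
  have J: "open_interval J" and xD: "\<And>t. t \<in> J \<Longrightarrow> x t \<in> qP_region"
    and dx: "\<And>t. t \<in> J \<Longrightarrow> (x has_vector_derivative g (x t)) (at t)"
    using sol by (auto simp: solution_in_def)
  have "1 - hs (x t) = 0"
  proof (rule vanishes_of_linear_bound[OF J, where b = "\<lambda>t. - 2 * radial_sum (x t)" and ?t0.0 = t0 and w = "\<lambda>t. 1 - hs (x t)"])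
    show "((\<lambda>t. 1 - hs (x t)) has_real_derivative - 2 * radial_sum (x t) * (1 - hs (x t))) (at t)" if "t \<in> J" for t
      by (rule hs_velocity_solution[OF dx[OF that]])
    show "0 \<le> 1 - hs (x t)" if "t \<in> J" for t using xD[OF that] by (simp add: qP_region_def)
    show "\<exists>C. \<forall>\<^sub>F r in at t. \<bar>- 2 * radial_sum (x r)\<bar> \<le> C" if tJ: "t \<in> J" "1 - hs (x t) = 0" for t
    proof -
      obtain C where C: "\<forall>\<^sub>F x in nhds (x t). \<bar>radial_sum x\<bar> \<le> C"
        using radial_sum_locally_bounded[of "x t"] xD[OF tJ(1)] tJ(2) by (auto simp: qP_region_def)
      have "(x \<longlongrightarrow> x t) (at t)"
        using has_vector_derivative_continuous[OF dx[OF tJ(1)]] by (simp add: isCont_def)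
      then have "\<forall>\<^sub>F r in at t. \<bar>radial_sum (x r)\<bar> \<le> C"
        using C by (rule eventually_compose_filterlim[rotated])
      then have "\<forall>\<^sub>F r in at t. \<bar>- 2 * radial_sum (x r)\<bar> \<le> 2 * C" by eventually_elim (simp add: abs_mult)
      then show ?thesis by blast
    qed
  qed (use t0 t in auto)
  then show ?thesis by simp
qed

text \<open>The vector \<open>B fhat\<close> of the definition of \<open>g\<^sub>d\<close>: along a directional solution its entry
  \<open>i0\<close> is \<open>-s'/s\<close> where \<open>s > 0\<close>, and the others are the \<open>\<theta>\<^sub>j'\<close>.\<close>

definition chart_velocity where
  "chart_velocity \<xi> s u = matrix_inv (dir_matrix i0 \<alpha> h \<xi> u) *v fhat \<alpha> k f h s (\<xi> u)"

lemma dir_field_nth: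
  "dir_field i0 \<alpha> k f h \<xi> s u $ i = (if i = i0 then - s else 1) * chart_velocity \<xi> s u $ i"
  unfolding dir_field_def chart_velocity_def[symmetric] matrix_vector_mult_def[of "\<chi> i j. _ i j"]
  by (simp add: if_distrib[of "\<lambda>x. x * _"] sum.delta cong: if_cong)

lemma dir_matrix_add_i0:
  "(dir_matrix i0 \<alpha> h \<xi> u *v (w + e *\<^sub>R axis i0 1)) $ i
    = (dir_matrix i0 \<alpha> h \<xi> u *v w) $ i + \<alpha> i * h (\<xi> u) $ i * e"
proof -
  have "dir_matrix i0 \<alpha> h \<xi> u *v axis i0 1 = column i0 (dir_matrix i0 \<alpha> h \<xi> u)"
    by (rule matrix_vector_mult_basis)
  then show ?thesis
    by (simp add: matrix_vector_right_distrib 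
        matrix_vector_mult_scaleR column_def dir_matrix_def mult_ac)
qed

text \<open>Write \<open>q = B fhat\<close>. The velocity of \<open>x = Phi (s, \<theta>)\<close> is \<open>\<rho>^(-\<alpha>\<^sub>i) (A (-\<rho>'/\<rho>, q\<^sub>\<theta>))\<^sub>i\<close>, and
  \<open>(-\<rho>'/\<rho>, q\<^sub>\<theta>)\<close> is \<open>q\<close> with its entry \<open>i0\<close> changed by \<open>-L\<close>, where \<open>L = \<rho>'/\<rho> + q\<^sub>i\<^sub>0\<close>. Since \<open>A q = fhat\<close>,
  this is \<open>\<rho>\<^sup>k ftilde\<^sub>i - \<alpha>\<^sub>i x\<^sub>i L\<close>, and it remains to see that \<open>L = \<rho>\<^sup>k S / c\<close>.\<close>

lemma Phi_velocity:
  assumes sol: "dir_solution i0 \<alpha> k f M atlas h J \<gamma>" and t: "t \<in> J"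
  shows "((\<lambda>r. Phi (\<gamma> r)) has_vector_derivative rho (fst (\<gamma> t)) (snd (\<gamma> t)) ^ k *\<^sub>R g (Phi (\<gamma> t))) (at t)"
proof -
  have J: "open J" and cont: "continuous_on J \<gamma>" and in_X: "\<And>r. r \<in> J \<Longrightarrow> \<gamma> r \<in> {0..} \<times> M"
    using sol by (auto simp: dir_solution_def open_interval_def)
  have in_M: "snd (\<gamma> r) \<in> M" and fst_nonneg: "fst (\<gamma> r) \<ge> 0" if "r \<in> J" for r
    using in_X[OF that] by (auto simp: mem_Times_iff)
  note tX = fst_nonneg[OF t] in_M[OF t]
  obtain P \<xi> where at: "(P, \<xi>) \<in> atlas" and in_P: "snd (\<gamma> t) \<in> \<xi> ` P"
    using chart_exists[OF tX(2)] by blast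
  define v where "v r = inv_into P \<xi> (snd (\<gamma> r))" for r
  define s where "s r = fst (\<gamma> r)" for r
  define q where "q = chart_velocity \<xi> (s t) (v t)"
  define A where "A = dir_matrix i0 \<alpha> h \<xi> (v t)"
  have "((\<lambda>r. dir_coords i0 P \<xi> (\<gamma> r)) has_vector_derivative dir_field i0 \<alpha> k f h \<xi> (s t) (v t)) (at t)"
    using sol t at in_P unfolding dir_solution_def s_def v_def by fast
  then have dcoord: "((\<lambda>r. dir_coords i0 P \<xi> (\<gamma> r) $ i) has_real_derivative
      (if i = i0 then - s t else 1) * q $ i) (at t)" for i
    unfolding has_vector_derivative_vec_iff dir_field_nth q_def by blast
  have ds: "(s has_real_derivative - s t * q $ i0) (at t)"
    using dcoord[of i0] by (simp add: dir_coords_def s_def[abs_def])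
  have ev_J: "\<forall>\<^sub>F r in nhds t. r \<in> J" using J t by (simp add: eventually_nhds_in_open)
  have "\<forall>\<^sub>F r in nhds t. snd (\<gamma> r) \<in> \<xi> ` P"
  proof -
    obtain T where T: "open T" "\<xi> ` P = M \<inter> T"
      using chart_open(2)[OF at] unfolding openin_open by blast
    have "(\<gamma> \<longlongrightarrow> \<gamma> t) (nhds t)"
      using cont J t by (simp add: continuous_on_eq_continuous_at isCont_def tendsto_nhds_iff)
    then have "((\<lambda>r. snd (\<gamma> r)) \<longlongrightarrow> snd (\<gamma> t)) (nhds t)" by (rule tendsto_snd)
    then have "\<forall>\<^sub>F r in nhds t. snd (\<gamma> r) \<in> T"
      using T in_P by (intro topological_tendstoD) auto
    with ev_J show ?thesis
      by eventually_elim (use in_M T in auto)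
  qed
  then have v: "\<forall>\<^sub>F r in nhds t. v r \<in> P \<and> \<xi> (v r) = snd (\<gamma> r)"
    by eventually_elim (auto simp: v_def inv_into_into f_inv_into_f)
  then have vP: "\<forall>\<^sub>F r in nhds t. v r \<in> P" by eventually_elim simp
  have \<xi>v: "\<xi> (v t) = snd (\<gamma> t)" and vtP: "v t \<in> P" using eventually_nhds_x_imp_x[OF v] by auto
  have v0: "\<forall>\<^sub>F r in nhds t. v r $ i0 = 0"
    using vP by eventually_elim (use openin_imp_subset[OF chart_open(1)[OF at]] in blast)
  define v' where "v' = (\<chi> j. if j = i0 then 0 else q $ j)"
  have dv: "(v has_vector_derivative v') (at t)"
    unfolding has_vector_derivative_vec_iff
  proof
    fix j show "((\<lambda>r. v r $ j) has_real_derivative v' $ j) (at t)"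
    proof (cases "j = i0")
      case True
      then show ?thesis using DERIV_cong_ev[OF refl v0 refl, of 0] by (simp add: v'_def)
    next
      case False
      then show ?thesis using dcoord[of j] by (simp add: dir_coords_def v_def v'_def)
    qed
  qed
  define \<rho> where "\<rho> r = root (2 * c) (s r ^ (2 * c) + hs (h (\<xi> (v r))))" for r
  have \<rho>t: "\<rho> t = rho (s t) (snd (\<gamma> t))" by (simp add: \<rho>_def rho_def \<xi>v)
  have \<rho>pos: "\<rho> t > 0" using rho_pos[OF tX(2)] by (simp add: \<rho>t)
  have "\<exists>\<rho>'. (\<rho> has_real_derivative \<rho>') (at t)"
  proof -
    have "\<exists>d. ((\<lambda>r. s r ^ (2 * c) + hs (h (\<xi> (v r)))) has_real_derivative d) (at t)"
      unfolding hsum_def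
      by (rule exI, rule DERIV_add, rule DERIV_power[OF ds], rule DERIV_sum, rule DERIV_cmult,
          rule DERIV_power[OF h_chart_velocity[OF at vP dv]])
    then obtain d where d: "((\<lambda>r. s r ^ (2 * c) + hs (h (\<xi> (v r)))) has_real_derivative d) (at t)" ..
    have pos: "s t ^ (2 * c) + hs (h (\<xi> (v t))) > 0" using rho_arg_pos[OF tX(2)] by (simp add: \<xi>v)
    have n: "2 * c > 0" using c_pos by simp
    show ?thesis
      unfolding \<rho>_def by (rule exI, rule DERIV_chain2[OF DERIV_real_root[OF n pos] d])
  qed
  then obtain \<rho>' where d\<rho>: "(\<rho> has_real_derivative \<rho>') (at t)" by blast
  define x where "x r = Phi (\<gamma> r)" for r
  have ev_x: "\<forall>\<^sub>F r in nhds t. x r = dir_point \<alpha> h (\<rho> r) (\<xi> (v r))"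
    using v by eventually_elim (simp add: x_def Phi_def \<rho>_def rho_def s_def)
  have xt: "x t $ i = h (\<xi> (v t)) $ i / \<rho> t ^ \<alpha> i" for i
    using eventually_nhds_x_imp_x[OF ev_x] by (simp add: dir_point_def)
  define L where "L = \<rho>' / \<rho> t + q $ i0"
  have Aq: "A *v q = fhat \<alpha> k f h (s t) (snd (\<gamma> t))"
    using matrix_inv_right[OF chart_inv[OF at vtP]]
    by (simp add: q_def chart_velocity_def A_def matrix_vector_mul_assoc \<xi>v)
  have dx: "((\<lambda>r. x r $ i) has_real_derivative \<rho> t ^ k * ft (x t) $ i - \<alpha> i * x t $ i * L) (at t)" for i
  proof -
    have "(\<chi> j. if j = i0 then - \<rho>' / \<rho> t else v' $ j) = q + (- L) *\<^sub>R axis i0 1"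
      by (simp add: vec_eq_iff L_def v'_def axis_def)
    then have "((\<lambda>r. dir_point \<alpha> h (\<rho> r) (\<xi> (v r)) $ i) has_real_derivative
        ((A *v q) $ i + \<alpha> i * h (\<xi> (v t)) $ i * (- L)) / \<rho> t ^ \<alpha> i) (at t)"
      using dir_point_velocity[OF at vP dv d\<rho> \<rho>pos, of i] dir_matrix_add_i0[of \<xi> "v t" q "- L" i]
      by (simp add: A_def)
    moreover have "(A *v q) $ i = \<rho> t ^ (k + \<alpha> i) * ft (x t) $ i"
      unfolding Aq using fhat_eq_ft[of "s t" "snd (\<gamma> t)" i] tX by (simp add: \<rho>t s_def x_def)
    moreover have "\<forall>\<^sub>F r in nhds t. x r $ i = dir_point \<alpha> h (\<rho> r) (\<xi> (v r)) $ i"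
      using ev_x by eventually_elim simp
    ultimately show ?thesis
      using \<rho>pos DERIV_cong_ev[OF refl _ refl, of "\<lambda>r. x r $ i"]
      by (simp add: xt power_add diff_divide_distrib mult_ac)
  qed
  \<comment> \<open>Compare the derivatives of both sides of \<open>hsum x = 1 - (s/\<rho>)\<^sup>2\<^sup>c\<close>.\<close>
  have "\<rho> t ^ k * radial_sum (x t) = c * L"
  proof -
    have "((\<lambda>r. 1 - (s r / \<rho> r) ^ (2 * c)) has_real_derivative
        - (real (2 * c) * (s t / \<rho> t) ^ (2 * c - 1) * ((- s t * q $ i0 * \<rho> t - s t * \<rho>') / (\<rho> t * \<rho> t)))) (at t)"
      using ds d\<rho> \<rho>pos by (auto intro!: derivative_eq_intros)
    moreover have "- (real (2 * c) * (s t / \<rho> t) ^ (2 * c - 1) * ((- s t * q $ i0 * \<rho> t - s t * \<rho>') / (\<rho> t * \<rho> t)))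
        = 2 * c * (s t / \<rho> t) ^ (2 * c) * L"
    proof -
      have "(- s t * q $ i0 * \<rho> t - s t * \<rho>') / (\<rho> t * \<rho> t) = - (s t / \<rho> t * L)"
        using \<rho>pos by (simp add: L_def field_simps)
      moreover have "(s t / \<rho> t) ^ (2 * c) = (s t / \<rho> t) ^ (2 * c - 1) * (s t / \<rho> t)"
        using c_pos by (intro power_minus_mult[symmetric]) simp
      ultimately show ?thesis by (simp only: mult_minus_right minus_minus mult.assoc of_nat_mult)
    qed
    ultimately have "((\<lambda>r. 1 - (s r / \<rho> r) ^ (2 * c)) has_real_derivative
        2 * c * (s t / \<rho> t) ^ (2 * c) * L) (at t)"
      by (simp only:)
    moreover have ev: "\<forall>\<^sub>F r in nhds t. hs (x r) = 1 - (s r / \<rho> r) ^ (2 * c)"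
      using ev_J v by eventually_elim
        (use hs_Phi in_X in \<open>simp add: x_def s_def \<rho>_def rho_def\<close>)
    ultimately have "((\<lambda>r. hs (x r)) has_real_derivative 2 * c * (s t / \<rho> t) ^ (2 * c) * L) (at t)"
      using DERIV_cong_ev[OF refl ev refl] by simp
    from DERIV_unique[OF hs_velocity[OF dx] this]
    have "2 * \<rho> t ^ k * radial_sum (x t) = 2 * c * L * (hs (x t) + (s t / \<rho> t) ^ (2 * c))"
      by (simp add: algebra_simps)
    then show ?thesis using eventually_nhds_x_imp_x[OF ev] by simp
  qed
  then have L: "L = \<rho> t ^ k * (radial_sum (x t) / c)" using c_pos by (simp add: field_simps)
  have "((\<lambda>r. x r $ i) has_real_derivative (\<rho> t ^ k *\<^sub>R g (x t)) $ i) (at t)" for i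
    using dx[of i] unfolding L by (simp add: qP_field_nth algebra_simps)
  then have "(x has_vector_derivative \<rho> t ^ k *\<^sub>R g (x t)) (at t)"
    unfolding has_vector_derivative_vec_iff by blast
  then show ?thesis by (simp add: x_def[abs_def] \<rho>t s_def)
qed

text \<open>The computation for \<open>Phi_velocity\<close>, run backwards: \<open>\<rho>\<close> and \<open>\<theta>\<close> are differentiable along \<open>x\<close> because
  \<open>Th\<close> is, and the invertibility of \<open>A\<close> yields their derivatives. The remaining coordinate \<open>s\<close> vanishes
  identically on solutions in the horizon; on the other solutions it is a differentiable function of
  \<open>\<rho>\<close> and \<open>hsum x\<close>.\<close>

lemma Psi_velocity:
  assumes sol: "solution_in qP_region g J x" and t: "t \<in> J"
    and at: "(P, \<xi>) \<in> atlas" and in_P: "snd (Psi (x t)) \<in> \<xi> ` P"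
  shows "((\<lambda>r. dir_coords i0 P \<xi> (Psi (x r))) has_vector_derivative
    (1 / fst (Th (x t)) ^ k) *\<^sub>R
      dir_field i0 \<alpha> k f h \<xi> (fst (Psi (x t))) (inv_into P \<xi> (snd (Psi (x t))))) (at t)"
proof -
  have J: "open J" and xD: "\<And>r. r \<in> J \<Longrightarrow> x r \<in> qP_region"
    and dx: "(x has_vector_derivative g (x t)) (at t)"
    using sol t by (auto simp: solution_in_def open_interval_def)
  have xV: "x r \<in> V" if "r \<in> J" for r using xD[OF that] by (simp add: qP_region_def)
  define \<rho> where "\<rho> r = fst (Th (x r))" for r
  define \<theta> where "\<theta> r = snd (Th (x r))" for r
  define v where "v r = inv_into P \<xi> (\<theta> r)" for r
  define s where "s r = fst (Psi (x r))" for r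
  define q where "q = chart_velocity \<xi> (s t) (v t)"
  define A where "A = dir_matrix i0 \<alpha> h \<xi> (v t)"
  have snd_Psi: "snd (Psi y) = snd (Th y)" for y by (simp add: Psi_def)
  have \<theta>t: "\<theta> t \<in> \<xi> ` P" using in_P by (simp add: snd_Psi \<theta>_def)
  have ev_J: "\<forall>\<^sub>F r in nhds t. r \<in> J" using J t by (simp add: eventually_nhds_in_open)
  have \<theta>M: "\<theta> r \<in> M" and \<rho>0: "\<rho> r > 0" if "r \<in> J" for r
    using Th_V[OF xV[OF that]] by (auto simp: \<theta>_def \<rho>_def)
  have contx: "(x \<longlongrightarrow> x t) (nhds t)"
    using has_vector_derivative_continuous[OF dx] by (simp add: isCont_def tendsto_nhds_iff)
  obtain Th' where Th': "((\<lambda>r. Th (x r)) has_vector_derivative Th') (at t)"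
  proof -
    obtain W F F' where W: "open W" "x t \<in> W" and F': "(F has_derivative F') (at (x t))"
      and F: "\<forall>z\<in>W \<inter> V. F z = Th z"
      using smooth_map_local_derivative[OF Th_smooth xV[OF t]] by blast
    have "((\<lambda>r. F (x r)) has_vector_derivative F' (g (x t))) (at t)"
      using vector_derivative_diff_chain_within[OF dx, of F F'] F'
      by (simp add: o_def has_derivative_at_withinI)
    moreover have "\<forall>\<^sub>F r in nhds t. x r \<in> W" using contx W by (intro topological_tendstoD)
    with ev_J have "\<forall>\<^sub>F r in nhds t. F (x r) = Th (x r)"
      by eventually_elim (use F xV in blast)
    ultimately have "((\<lambda>r. Th (x r)) has_vector_derivative F' (g (x t))) (at t)"
      by (rule has_vector_derivative_eventually_eq)
    then show ?thesis by (rule that)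
  qed
  have d\<rho>: "(\<rho> has_real_derivative fst Th') (at t)"
    using bounded_linear.has_vector_derivative[OF bounded_linear_fst Th']
    by (simp add: \<rho>_def[abs_def] has_real_derivative_iff_has_vector_derivative)
  have d\<theta>: "(\<theta> has_vector_derivative snd Th') (at t)"
    using bounded_linear.has_vector_derivative[OF bounded_linear_snd Th']
    by (simp add: \<theta>_def[abs_def])
  have cont\<theta>: "(\<theta> \<longlongrightarrow> \<theta> t) (nhds t)"
    using has_vector_derivative_continuous[OF d\<theta>] by (simp add: isCont_def tendsto_nhds_iff)
  have ev_P: "\<forall>\<^sub>F r in nhds t. \<theta> r \<in> \<xi> ` P"
  proof -
    obtain T where T: "open T" "\<xi> ` P = M \<inter> T"
      using chart_open(2)[OF at] unfolding openin_open by blast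
    have "\<forall>\<^sub>F r in nhds t. \<theta> r \<in> T"
      using cont\<theta> T \<theta>t by (intro topological_tendstoD) auto
    with ev_J show ?thesis
      by eventually_elim (use \<theta>M T in auto)
  qed
  then have v: "\<forall>\<^sub>F r in nhds t. v r \<in> P \<and> \<xi> (v r) = \<theta> r"
    by eventually_elim (auto simp: v_def inv_into_into f_inv_into_f)
  then have vP: "\<forall>\<^sub>F r in nhds t. v r \<in> P" by eventually_elim simp
  have \<xi>v: "\<xi> (v t) = \<theta> t" and vtP: "v t \<in> P" using eventually_nhds_x_imp_x[OF v] by auto
  obtain v' where dv: "(v has_vector_derivative v') (at t)"
  proof -
    obtain W F F' where W: "open W" "\<theta> t \<in> W" and F': "(F has_derivative F') (at (\<theta> t))"
      and F: "\<forall>z\<in>W \<inter> \<xi> ` P. F z = inv_into P \<xi> z"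
      using smooth_map_local_derivative[OF chart_smooth(2)[OF at] \<theta>t] by blast
    have "((\<lambda>r. F (\<theta> r)) has_vector_derivative F' (snd Th')) (at t)"
      using vector_derivative_diff_chain_within[OF d\<theta>, of F F'] F'
      by (simp add: o_def has_derivative_at_withinI)
    moreover have "\<forall>\<^sub>F r in nhds t. \<theta> r \<in> W" using cont\<theta> W by (intro topological_tendstoD)
    with ev_P have "\<forall>\<^sub>F r in nhds t. F (\<theta> r) = v r"
      by eventually_elim (use F in \<open>simp add: v_def\<close>)
    ultimately have "(v has_vector_derivative F' (snd Th')) (at t)"
      by (rule has_vector_derivative_eventually_eq)
    then show ?thesis by (rule that)
  qed
  define w where "w = (\<chi> j. if j = i0 then - fst Th' / \<rho> t else v' $ j)"
  have \<rho>pos: "\<rho> t > 0" by (rule \<rho>0[OF t])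
  have ev_x: "\<forall>\<^sub>F r in nhds t. x r = dir_point \<alpha> h (\<rho> r) (\<xi> (v r))"
    using ev_J v by eventually_elim (use y_eq xV in \<open>simp add: \<rho>_def \<theta>_def\<close>)
  have xt: "x t $ i = h (\<xi> (v t)) $ i / \<rho> t ^ \<alpha> i" for i
    using eventually_nhds_x_imp_x[OF ev_x] by (simp add: dir_point_def)
  define S where "S = radial_sum (x t) / c"
  have sX: "s t \<ge> 0" and rhot: "rho (s t) (\<theta> t) = \<rho> t" and Phit: "Phi (s t, \<theta> t) = x t"
    using Psi_in[OF xD[OF t]] rho_Psi[OF xD[OF t]] Phi_Psi[OF xD[OF t]]
    by (auto simp: s_def \<theta>_def \<rho>_def snd_Psi mem_Times_iff simp flip: snd_Psi)
  \<comment> \<open>Apply \<open>A\<close> to both sides: the velocity of \<open>x\<close> is known from \<open>x' = g(x)\<close>.\<close>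
  have w_eq: "w + S *\<^sub>R axis i0 1 = (1 / \<rho> t ^ k) *\<^sub>R q"
  proof -
    have "(A *v (w + S *\<^sub>R axis i0 1)) $ i = ((1 / \<rho> t ^ k) *\<^sub>R fhat \<alpha> k f h (s t) (\<theta> t)) $ i" for i
    proof -
      have "\<forall>\<^sub>F r in nhds t. x r $ i = dir_point \<alpha> h (\<rho> r) (\<xi> (v r)) $ i"
        using ev_x by eventually_elim simp
      from DERIV_cong_ev[OF refl this refl, of "(A *v w) $ i / \<rho> t ^ \<alpha> i"]
      have "((\<lambda>r. x r $ i) has_real_derivative (A *v w) $ i / \<rho> t ^ \<alpha> i) (at t)"
        using dir_point_velocity[OF at vP dv d\<rho> \<rho>pos, of i] by (simp add: A_def w_def)
      moreover have "((\<lambda>r. x r $ i) has_real_derivative g (x t) $ i) (at t)"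
        using dx unfolding has_vector_derivative_vec_iff by blast
      ultimately have "(A *v w) $ i / \<rho> t ^ \<alpha> i = g (x t) $ i" by (rule DERIV_unique)
      then have "(A *v w) $ i = \<rho> t ^ \<alpha> i * (ft (x t) $ i - \<alpha> i * x t $ i * S)"
        using \<rho>pos by (simp add: qP_field_nth S_def field_simps)
      also have "\<dots> = \<rho> t ^ \<alpha> i * ft (x t) $ i - \<alpha> i * h (\<xi> (v t)) $ i * S"
        using \<rho>pos by (simp add: xt field_simps)
      finally have "(A *v (w + S *\<^sub>R axis i0 1)) $ i = \<rho> t ^ \<alpha> i * ft (x t) $ i"
        by (simp add: A_def dir_matrix_add_i0)
      moreover have "fhat \<alpha> k f h (s t) (\<theta> t) $ i = \<rho> t ^ (k + \<alpha> i) * ft (x t) $ i"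
        using fhat_eq_ft[OF sX \<theta>M[OF t], of i] by (simp add: rhot Phit)
      ultimately show ?thesis using \<rho>pos by (simp add: power_add)
    qed
    then have "A *v (w + S *\<^sub>R axis i0 1) = (1 / \<rho> t ^ k) *\<^sub>R fhat \<alpha> k f h (s t) (\<theta> t)"
      by (simp add: vec_eq_iff)
    then have "matrix_inv A *v (A *v (w + S *\<^sub>R axis i0 1)) = (1 / \<rho> t ^ k) *\<^sub>R q"
      by (simp add: q_def chart_velocity_def A_def \<xi>v matrix_vector_mult_scaleR)
    then show ?thesis
      using matrix_inv_left[OF chart_inv[OF at vtP]] by (simp add: matrix_vector_mul_assoc A_def)
  qed
  have v'q: "v' $ j = 1 / \<rho> t ^ k * q $ j" if "j \<noteq> i0" for j
    using arg_cong[OF w_eq, of "\<lambda>z. z $ j"] that by (simp add: w_def axis_def)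
  have q0: "- fst Th' / \<rho> t + S = 1 / \<rho> t ^ k * q $ i0"
    using arg_cong[OF w_eq, of "\<lambda>z. z $ i0"] by (simp add: w_def)
  have s_eq: "s r = \<rho> r * root (2 * c) (1 - hs (x r))" if "r \<in> J" for r
    using fst_Psi[OF xD[OF that]] by (simp add: s_def \<rho>_def)
  have ev_s: "\<forall>\<^sub>F r in nhds t. s r = \<rho> r * root (2 * c) (1 - hs (x r))"
    using ev_J by eventually_elim (rule s_eq)
  have ds: "(s has_real_derivative - s t * (1 / \<rho> t ^ k * q $ i0)) (at t)"
  proof (cases "hs (x t) = 1")
    case True
    have ev0: "\<forall>\<^sub>F r in nhds t. s r = 0"
      using ev_J by eventually_elim (simp add: s_eq horizon_invariant[OF sol t True])
    then have "s t = 0" by (rule eventually_nhds_x_imp_x)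
    then show ?thesis using DERIV_cong_ev[OF refl ev0 refl, of 0] by simp
  next
    case False
    define W where "W = root (2 * c) (1 - hs (x t))"
    have pos: "1 - hs (x t) > 0" using xD[OF t] False by (simp add: qP_region_def)
    then have Wpos: "W > 0" and WW: "W ^ (2 * c) = 1 - hs (x t)" using c_pos by (auto simp: W_def)
    have n: "2 * c > 0" using c_pos by simp
    have "((\<lambda>r. root (2 * c) (1 - hs (x r))) has_real_derivative
        inverse (real (2 * c) * W ^ (2 * c - Suc 0)) * (- 2 * radial_sum (x t) * (1 - hs (x t)))) (at t)"
      unfolding W_def by (rule DERIV_chain2[OF DERIV_real_root[OF n pos] hs_velocity_solution[OF dx]])
    moreover have "inverse (real (2 * c) * W ^ (2 * c - Suc 0)) * (- 2 * radial_sum (x t) * (1 - hs (x t))) = - S * W"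
    proof -
      have "2 * c = Suc (2 * c - Suc 0)" using c_pos by simp
      then have "W ^ (2 * c) = W * W ^ (2 * c - Suc 0)" by (metis power_Suc)
      then show ?thesis unfolding WW[symmetric] S_def using Wpos c_pos by (simp add: field_simps)
    qed
    ultimately have "((\<lambda>r. root (2 * c) (1 - hs (x r))) has_real_derivative - S * W) (at t)" by simp
    from DERIV_mult[OF d\<rho> this]
    have "((\<lambda>r. \<rho> r * root (2 * c) (1 - hs (x r))) has_real_derivative
        fst Th' * W + - S * W * \<rho> t) (at t)" by (simp add: W_def)
    moreover have "fst Th' * W + - S * W * \<rho> t = - s t * (- fst Th' / \<rho> t + S)"
    proof -
      have "s t = \<rho> t * W" by (simp add: s_eq[OF t] W_def)
      then show ?thesis using \<rho>pos by (simp add: field_simps)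
    qed
    ultimately show ?thesis
      unfolding q0 using DERIV_cong_ev[OF refl ev_s refl] by simp
  qed
  show ?thesis
    unfolding has_vector_derivative_vec_iff
  proof
    fix i
    have *: "((1 / fst (Th (x t)) ^ k) *\<^sub>R
        dir_field i0 \<alpha> k f h \<xi> (fst (Psi (x t))) (inv_into P \<xi> (snd (Psi (x t))))) $ i
      = 1 / \<rho> t ^ k * ((if i = i0 then - s t else 1) * q $ i)"
      by (simp add: dir_field_nth q_def s_def \<rho>_def v_def \<theta>_def snd_Psi)
    show "((\<lambda>r. dir_coords i0 P \<xi> (Psi (x r)) $ i) has_real_derivative
      ((1 / fst (Th (x t)) ^ k) *\<^sub>R
        dir_field i0 \<alpha> k f h \<xi> (fst (Psi (x t))) (inv_into P \<xi> (snd (Psi (x t))))) $ i) (at t)"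
    proof (cases "i = i0")
      case True
      then show ?thesis unfolding * using ds by (simp add: dir_coords_def s_def[abs_def])
    next
      case False
      have "((\<lambda>r. v r $ i) has_real_derivative v' $ i) (at t)"
        using dv unfolding has_vector_derivative_vec_iff by blast
      then show ?thesis unfolding * using False v'q[OF False]
        by (simp add: dir_coords_def v_def[abs_def] \<theta>_def snd_Psi)
    qed
  qed
qed

section \<open>Topological equivalence\<close>

lemma dir_qP_topological_equivalence:
  "topological_equivalence ({0..} \<times> M) (dir_solution i0 \<alpha> k f M atlas h) qP_region (solution_in qP_region g) Phi"
proof (rule topological_equivalence_time_change[OF Phi_homeomorphism])
  define m where "m z = rho (fst z) (snd z) ^ k" for z
  show "open_interval J \<and> \<gamma> ` J \<subseteq> {0..} \<times> M \<and> continuous_on J \<gamma>"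
    if "dir_solution i0 \<alpha> k f M atlas h J \<gamma>" for J \<gamma>
    using that by (auto simp: dir_solution_def)
  show "open_interval J \<and> x ` J \<subseteq> qP_region \<and> continuous_on J x" if "solution_in qP_region g J x" for J x
    using that has_vector_derivative_continuous
    by (fastforce simp: solution_in_def intro!: continuous_at_imp_continuous_on)
  show "continuous_on ({0..} \<times> M) m"
    unfolding m_def by (intro continuous_on_power continuous_on_subset[OF cont_rho]) auto
  show "m z > 0" if "z \<in> {0..} \<times> M" for z
    using that rho_pos by (auto simp: m_def)
  show "solution_in qP_region g K (\<lambda>r. Phi (\<gamma> (\<sigma> r)))"
    if sol: "dir_solution i0 \<alpha> k f M atlas h J \<gamma>" and K: "open_interval K" "\<sigma> ` K = J"
      and d\<sigma>: "\<And>r. r \<in> K \<Longrightarrow> (\<sigma> has_real_derivative 1 / m (\<gamma> (\<sigma> r))) (at r)" for J \<gamma> K \<sigma>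
    unfolding solution_in_def
  proof (intro conjI ballI K(1))
    fix r assume r: "r \<in> K"
    then have \<sigma>r: "\<sigma> r \<in> J" using K(2) by blast
    then have X: "\<gamma> (\<sigma> r) \<in> {0..} \<times> M" using sol by (simp add: dir_solution_def)
    then show "Phi (\<gamma> (\<sigma> r)) \<in> qP_region" by (rule Phi_D)
    have "m (\<gamma> (\<sigma> r)) > 0" using X rho_pos by (auto simp: m_def)
    moreover have "((\<lambda>r. Phi (\<gamma> (\<sigma> r))) has_vector_derivative
        (1 / m (\<gamma> (\<sigma> r))) *\<^sub>R (m (\<gamma> (\<sigma> r)) *\<^sub>R g (Phi (\<gamma> (\<sigma> r))))) (at r)"
      by (rule has_vector_derivative_time_change[OF d\<sigma>[OF r] Phi_velocity[OF sol \<sigma>r, folded m_def]])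
    ultimately show "((\<lambda>r. Phi (\<gamma> (\<sigma> r))) has_vector_derivative g (Phi (\<gamma> (\<sigma> r)))) (at r)" by simp
  qed
  show "dir_solution i0 \<alpha> k f M atlas h K (\<lambda>r. Psi (x (\<sigma> r)))"
    if sol: "solution_in qP_region g J x" and K: "open_interval K" "\<sigma> ` K = J"
      and d\<sigma>: "\<And>r. r \<in> K \<Longrightarrow> (\<sigma> has_real_derivative m (Psi (x (\<sigma> r)))) (at r)" for J x K \<sigma>
    unfolding dir_solution_def
  proof (intro conjI ballI K(1))
    have \<sigma>J: "\<sigma> r \<in> J" if "r \<in> K" for r using K(2) that by blast
    have xD: "x t \<in> qP_region" if "t \<in> J" for t using sol that by (simp add: solution_in_def)
    have "continuous_on J x"
      using sol has_vector_derivative_continuous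
      by (fastforce simp: solution_in_def intro!: continuous_at_imp_continuous_on)
    moreover have "continuous_on K \<sigma>"
      using d\<sigma> DERIV_isCont by (fast intro!: continuous_at_imp_continuous_on)
    ultimately have cont: "continuous_on K (\<lambda>r. x (\<sigma> r))"
      by (rule continuous_on_compose2) (use \<sigma>J in blast)
    show "continuous_on K (\<lambda>r. Psi (x (\<sigma> r)))"
      by (rule continuous_on_compose2[OF homeomorphism_cont2[OF Phi_homeomorphism] cont])
        (use \<sigma>J xD in blast)
    fix r assume r: "r \<in> K"
    note xr = xD[OF \<sigma>J[OF r]]
    show "Psi (x (\<sigma> r)) \<in> {0..} \<times> M" by (rule Psi_in[OF xr])
    have m: "m (Psi (x (\<sigma> r))) = fst (Th (x (\<sigma> r))) ^ k"
      by (simp add: m_def rho_Psi[OF xr])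
    have "fst (Th (x (\<sigma> r))) > 0" using Th_V(1) xr by (simp add: qP_region_def)
    then have mpos: "m (Psi (x (\<sigma> r))) > 0" by (simp add: m)
    show "case p of (P, \<xi>) \<Rightarrow> snd (Psi (x (\<sigma> r))) \<in> \<xi> ` P \<longrightarrow>
        ((\<lambda>r. dir_coords i0 P \<xi> (Psi (x (\<sigma> r)))) has_vector_derivative
          dir_field i0 \<alpha> k f h \<xi> (fst (Psi (x (\<sigma> r)))) (inv_into P \<xi> (snd (Psi (x (\<sigma> r)))))) (at r)"
      if "p \<in> atlas" for p
    proof (cases p, clarsimp)
      fix P \<xi> u assume p: "p = (P, \<xi>)" and u: "snd (Psi (x (\<sigma> r))) = \<xi> u" "u \<in> P"
      have at: "(P, \<xi>) \<in> atlas" using that p by simp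
      have in_P: "snd (Psi (x (\<sigma> r))) \<in> \<xi> ` P" using u by simp
      let ?d = "dir_field i0 \<alpha> k f h \<xi> (fst (Psi (x (\<sigma> r)))) (inv_into P \<xi> (snd (Psi (x (\<sigma> r)))))"
      have "((\<lambda>r. dir_coords i0 P \<xi> (Psi (x (\<sigma> r)))) has_vector_derivative
          m (Psi (x (\<sigma> r))) *\<^sub>R ((1 / m (Psi (x (\<sigma> r)))) *\<^sub>R ?d)) (at r)"
        by (rule has_vector_derivative_time_change[OF d\<sigma>[OF r] Psi_velocity[OF sol \<sigma>J[OF r] at in_P, folded m]])
      then show "((\<lambda>r. dir_coords i0 P \<xi> (Psi (x (\<sigma> r)))) has_vector_derivative
          dir_field i0 \<alpha> k f h \<xi> (fst (Psi (x (\<sigma> r)))) (inv_into P \<xi> (\<xi> u))) (at r)"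
        using mpos by (simp add: u(1))
    qed
  qed
qed

end

theorem theorem3p13:
  fixes \<alpha> \<beta> :: "'n::finite \<Rightarrow> nat" and a :: "'n \<Rightarrow> real" and c k :: nat
    and U :: "(real^'n) set" and f fak :: "real^'n \<Rightarrow> real^'n"
    and i0 :: 'n and M :: "'m::euclidean_space set"
    and atlas :: "((real^'n) set \<times> (real^'n \<Rightarrow> 'm)) set"
    and h :: "'m \<Rightarrow> real^'n" and V :: "(real^'n) set" and Th :: "real^'n \<Rightarrow> real \<times> 'm"
  assumes "\<exists>i. \<alpha> i \<noteq> 0" and "k \<ge> 1"
    and "asymptotically_quasi_homogeneous \<alpha> k U f fak"
    and "compactification_weights \<alpha> \<beta> a c"
    and "directional_compactification i0 \<alpha> \<beta> a c U M atlas h V Th"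
  shows "\<exists>\<Phi>. (\<forall>y\<in>V. \<Phi> (Th y) = TqP \<alpha> \<beta> a c y) \<and>
           \<Phi> ` ({0..} \<times> M) \<subseteq> qP_disk \<alpha> \<beta> a c U \<union> qP_horizon \<alpha> \<beta> a c U \<and>
           topological_equivalence
             ({0..} \<times> M) (dir_solution i0 \<alpha> k f M atlas h)
             (\<Phi> ` ({0..} \<times> M)) (solution_in (\<Phi> ` ({0..} \<times> M)) (qP_field \<alpha> \<beta> a c k f fak)) \<Phi>"
proof -
  interpret directional_and_qP \<alpha> \<beta> a c k U f fak i0 M atlas h V Th
    by unfold_locales (rule assms)+
  show ?thesis
  proof (intro exI[of _ Phi] conjI ballI)
    show "Phi (Th y) = TqP \<alpha> \<beta> a c y" if "y \<in> V" for y
      using Phi_eq_TqP[OF Th_V[OF that]] y_eq[OF that] by simp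
    show "Phi ` ({0..} \<times> M) \<subseteq> qP_disk \<alpha> \<beta> a c U \<union> qP_horizon \<alpha> \<beta> a c U"
    proof
      fix x assume "x \<in> Phi ` ({0..} \<times> M)"
      then obtain s \<theta> where z: "s \<ge> 0" "\<theta> \<in> M" "x = Phi (s, \<theta>)" by auto
      show "x \<in> qP_disk \<alpha> \<beta> a c U \<union> qP_horizon \<alpha> \<beta> a c U"
      proof (cases "s = 0")
        case True
        then have "hs x = 1" using hs_Phi[of "(s, \<theta>)"] z c_pos by simp
        moreover have "x \<in> U" using Phi_V[of "(s, \<theta>)"] z VU by auto
        ultimately show ?thesis by (simp add: qP_horizon_def pfun_eq_1)
      next
        case False
        then have "x = TqP \<alpha> \<beta> a c (dir_point \<alpha> h s \<theta>)" "dir_point \<alpha> h s \<theta> \<in> U"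
          using Phi_eq_TqP dir_point_V(1) z VU by auto
        then show ?thesis by (simp add: qP_disk_def)
      qed
    qed
    show "topological_equivalence
             ({0..} \<times> M) (dir_solution i0 \<alpha> k f M atlas h)
             (Phi ` ({0..} \<times> M)) (solution_in (Phi ` ({0..} \<times> M)) (qP_field \<alpha> \<beta> a c k f fak)) Phi"
      unfolding Phi_image by (rule dir_qP_topological_equivalence)
  qed
qed

end
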